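(* Let $E$ and $F$ be vector lattices, with $E$ atomless and $F$ an order ideal of some Banach lattice with order continuous norm. Then an arbitrary abstract Uryson operator $T:E\to F$ is order narrow if and only if $|T|$ is order narrow.
   Context: Vector lattices are real. In a vector lattice $E$, an element $u>0$ is an atom if $0\le x\le u$, $0\le y\le u$, $x\wedge y=0$ imply $x=0$ or $y=0$; $E$ is atomless if it has no atom. For $x,y\in E$, $x\perp y$ means $|x|\wedge|y|=0$. The notation $x=y\sqcup z$ means $x=y+z$ and $y\perp z$. A net $(x_\alpha)$ order converges to $x$ if there is a net $(u_\alpha)$ with the same index set such that $u_\alpha\downarrow0$ and $|x_\alpha-x|\le u_\alpha$ for all $\alpha$. A (not necessarily linear) map $T:E\to F$ between vector lattices is orthogonally additive if $T(x+y)=T(x)+T(y)$ whenever $x\perp y$. An abstract Uryson operator is an orthogonally additive map that sends order bounded sets to order bounded sets; the set of these is $\mathcal U(E,F)$, ordered by: $S\le T$ iff $T(x)-S(x)\ge0$ in $F$ for all $x\in E$. If $F$ is Dedekind complete (which holds when $F$ is an ideal of a Banach lattice with order continuous norm), $\mathcal U(E,F)$ is a Dedekind complete vector lattice, and $|T|$ is the modulus in it: $|T|(x)=\sup\{T(y)-T(z): x=y\sqcup z\}$. A map $T:E\to F$ is order narrow if for every $e\in E$ there is a net of decompositions $e=f_\alpha\sqcup g_\alpha$ such that $T(f_\alpha)-T(g_\alpha)$ order converges to $0$ in $F$. *)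

theory Defs
  imports "HOL-Analysis.Analysis" "HOL-Library.Lattice_Algebras"
begin

section \<open>Vector lattices and Banach lattices\<close>

text \<open>The class \<^class>\<open>lattice_ab_group_add_abs\<close> contributes the lattice operations and the
  modulus, axiomatised as the supremum of \<open>x\<close> and \<open>- x\<close>.\<close>

class vector_lattice = ordered_real_vector + lattice_ab_group_add_abs

class banach_lattice = banach + vector_lattice +
  assumes norm_mono_abs: "\<bar>x\<bar> \<le> \<bar>y\<bar> \<Longrightarrow> norm x \<le> norm y"

definition lat_disjoint :: "'a::vector_lattice \<Rightarrow> 'a \<Rightarrow> bool" where
  "lat_disjoint x y \<longleftrightarrow> inf \<bar>x\<bar> \<bar>y\<bar> = 0"

definition disjoint_sum :: "'a::vector_lattice \<Rightarrow> 'a \<Rightarrow> 'a \<Rightarrow> bool" where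
  "disjoint_sum x y z \<longleftrightarrow> x = y + z \<and> lat_disjoint y z"

definition is_atom :: "'a::vector_lattice \<Rightarrow> bool" where
  "is_atom u \<longleftrightarrow> 0 < u \<and>
     (\<forall>x y. 0 \<le> x \<and> x \<le> u \<and> 0 \<le> y \<and> y \<le> u \<and> inf x y = 0 \<longrightarrow> x = 0 \<or> y = 0)"

definition atomless :: "'a::vector_lattice itself \<Rightarrow> bool" where
  "atomless _ \<longleftrightarrow> (\<nexists>u::'a. is_atom u)"

definition order_bounded :: "'a::vector_lattice set \<Rightarrow> bool" where
  "order_bounded A \<longleftrightarrow> (\<exists>a b. A \<subseteq> {a..b})"

definition order_ideal :: "'a::vector_lattice set \<Rightarrow> bool" where
  "order_ideal I \<longleftrightarrow> subspace I \<and> (\<forall>x\<in>I. \<forall>y. \<bar>y\<bar> \<le> \<bar>x\<bar> \<longrightarrow> y \<in> I)"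

text \<open>A vector lattice \<open>'f\<close>, being a type, is presented as an order ideal of \<open>'g\<close> by a linear
  lattice isomorphism onto an order ideal. Preservation of infima follows by linearity.\<close>

definition order_ideal_embedding :: "('f::vector_lattice \<Rightarrow> 'g::vector_lattice) \<Rightarrow> bool" where
  "order_ideal_embedding j \<longleftrightarrow>
     linear j \<and> inj j \<and> (\<forall>x y. j (sup x y) = sup (j x) (j y)) \<and> order_ideal (range j)"


section \<open>Nets\<close>

text \<open>A net is a function restricted to a set \<open>A\<close> directed by a preorder \<open>r\<close>
  (\<open>r a b\<close> meaning that \<open>b\<close> is later than \<open>a\<close>).\<close>

definition directed_set :: "'i set \<Rightarrow> ('i \<Rightarrow> 'i \<Rightarrow> bool) \<Rightarrow> bool" where
  "directed_set A r \<longleftrightarrow> A \<noteq> {} \<and> (\<forall>a\<in>A. r a a) \<and>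
     (\<forall>a\<in>A. \<forall>b\<in>A. \<forall>c\<in>A. r a b \<longrightarrow> r b c \<longrightarrow> r a c) \<and>
     (\<forall>a\<in>A. \<forall>b\<in>A. \<exists>c\<in>A. r a c \<and> r b c)"

definition decreases_to_0 ::
    "'i set \<Rightarrow> ('i \<Rightarrow> 'i \<Rightarrow> bool) \<Rightarrow> ('i \<Rightarrow> 'a::vector_lattice) \<Rightarrow> bool" where
  "decreases_to_0 A r u \<longleftrightarrow> (\<forall>a\<in>A. \<forall>b\<in>A. r a b \<longrightarrow> u b \<le> u a) \<and>
     (\<forall>a\<in>A. 0 \<le> u a) \<and> (\<forall>w. (\<forall>a\<in>A. w \<le> u a) \<longrightarrow> w \<le> 0)"

definition order_converges ::
    "'i set \<Rightarrow> ('i \<Rightarrow> 'i \<Rightarrow> bool) \<Rightarrow> ('i \<Rightarrow> 'a::vector_lattice) \<Rightarrow> 'a \<Rightarrow> bool" where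
  "order_converges A r x l \<longleftrightarrow>
     (\<exists>u. decreases_to_0 A r u \<and> (\<forall>a\<in>A. \<bar>x a - l\<bar> \<le> u a))"

text \<open>A definition cannot quantify over index types. Nets decreasing to \<open>0\<close> in \<open>'a\<close> may be
  re-indexed by their range, so index sets inside \<open>'a\<close> are enough; the lemma
  \<open>order_continuous_normD\<close> confirms this for arbitrary index types.\<close>

definition order_continuous_norm :: "'a::banach_lattice itself \<Rightarrow> bool" where
  "order_continuous_norm _ \<longleftrightarrow>
     (\<forall>(A::'a set) r (x::'a \<Rightarrow> 'a). directed_set A r \<and> decreases_to_0 A r x \<longrightarrow>
        (\<forall>\<epsilon>>0. \<exists>a\<in>A. \<forall>b\<in>A. r a b \<longrightarrow> norm (x b) < \<epsilon>))"

lemma directed_set_image: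
  assumes "directed_set A r" "decreases_to_0 A r u"
  shows "directed_set (u ` A) (\<lambda>x y. y \<le> x)" "decreases_to_0 (u ` A) (\<lambda>x y. y \<le> x) (\<lambda>x. x)"
proof -
  have "\<exists>z\<in>u ` A. z \<le> x \<and> z \<le> y" if xy: "x \<in> u ` A" "y \<in> u ` A" for x y
  proof -
    from xy obtain a b where ab: "a \<in> A" "b \<in> A" "x = u a" "y = u b" by auto
    then obtain c where "c \<in> A" "r a c" "r b c"
      using assms(1) unfolding directed_set_def by meson
    with ab assms(2) show ?thesis unfolding decreases_to_0_def by blast
  qed
  moreover have "u ` A \<noteq> {}" using assms(1) unfolding directed_set_def by simp
  ultimately show "directed_set (u ` A) (\<lambda>x y. y \<le> x)"
    unfolding directed_set_def
    by (intro conjI ballI impI order.refl) (assumption, erule (1) order.trans, simp)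
  show "decreases_to_0 (u ` A) (\<lambda>x y. y \<le> x) (\<lambda>x. x)"
    using assms(2) unfolding decreases_to_0_def by simp
qed

lemma order_continuous_normD:
  fixes x :: "'i \<Rightarrow> 'a::banach_lattice"
  assumes "order_continuous_norm TYPE('a)" "directed_set A r" "decreases_to_0 A r x" "\<epsilon> > 0"
  shows "\<exists>a\<in>A. \<forall>b\<in>A. r a b \<longrightarrow> norm (x b) < \<epsilon>"
proof -
  obtain d where d: "d \<in> x ` A" "\<And>e. e \<in> x ` A \<Longrightarrow> e \<le> d \<Longrightarrow> norm e < \<epsilon>"
    using assms(1)[unfolded order_continuous_norm_def, rule_format,
        OF conjI[OF directed_set_image[OF assms(2,3)]] assms(4)] by auto
  then obtain a where "a \<in> A" "d = x a" by auto
  moreover have "x b \<le> x a" if "b \<in> A" "r a b" for b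
    using assms(3) that \<open>a \<in> A\<close> unfolding decreases_to_0_def by simp
  ultimately show ?thesis using d(2) by auto
qed


section \<open>Abstract Uryson operators\<close>

definition orthogonally_additive :: "('e::vector_lattice \<Rightarrow> 'f::vector_lattice) \<Rightarrow> bool" where
  "orthogonally_additive T \<longleftrightarrow> (\<forall>x y. lat_disjoint x y \<longrightarrow> T (x + y) = T x + T y)"

definition uryson_operators :: "('e::vector_lattice \<Rightarrow> 'f::vector_lattice) set" where
  "uryson_operators =
     {T. orthogonally_additive T \<and> (\<forall>A. order_bounded A \<longrightarrow> order_bounded (T ` A))}"

definition uryson_le ::
    "('e::vector_lattice \<Rightarrow> 'f::vector_lattice) \<Rightarrow> ('e \<Rightarrow> 'f) \<Rightarrow> bool" where
  "uryson_le S T \<longleftrightarrow> (\<forall>x. 0 \<le> T x - S x)"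

text \<open>The modulus is the supremum of \<open>T\<close> and \<open>- T\<close> in the ordered space of abstract Uryson
  operators. It is unique when it exists, and it exists if \<open>'f\<close> is Dedekind complete;
  otherwise \<open>uryson_modulus T\<close> may be unspecified.\<close>

definition is_uryson_modulus ::
    "('e::vector_lattice \<Rightarrow> 'f::vector_lattice) \<Rightarrow> ('e \<Rightarrow> 'f) \<Rightarrow> bool" where
  "is_uryson_modulus T M \<longleftrightarrow> M \<in> uryson_operators \<and>
     uryson_le T M \<and> uryson_le (\<lambda>x. - T x) M \<and>
     (\<forall>S\<in>uryson_operators. uryson_le T S \<and> uryson_le (\<lambda>x. - T x) S \<longrightarrow> uryson_le M S)"

definition uryson_modulus ::
    "('e::vector_lattice \<Rightarrow> 'f::vector_lattice) \<Rightarrow> 'e \<Rightarrow> 'f" where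
  "uryson_modulus T = (THE M. is_uryson_modulus T M)"

lemma uryson_modulus_eqI: "is_uryson_modulus T M \<Longrightarrow> uryson_modulus T = M"
  unfolding uryson_modulus_def
  by (rule the_equality, assumption)
    (auto simp: is_uryson_modulus_def uryson_le_def fun_eq_iff intro!: order.antisym)


section \<open>Order narrow maps\<close>

text \<open>The index sets are taken inside \<open>'f\<close>. This is no restriction: a net over any index type
  can be re-indexed by the range of the net dominating it, see \<open>order_narrowI\<close> below.\<close>

definition order_narrow :: "('e::vector_lattice \<Rightarrow> 'f::vector_lattice) \<Rightarrow> bool" where
  "order_narrow T \<longleftrightarrow>
     (\<forall>e. \<exists>(A::'f set) r f g. directed_set A r \<and> (\<forall>a\<in>A. disjoint_sum e (f a) (g a)) \<and>
        order_converges A r (\<lambda>a. T (f a) - T (g a)) 0)"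

lemma order_narrowI:
  fixes T :: "'e::vector_lattice \<Rightarrow> 'f::vector_lattice"
  assumes "\<And>e. \<exists>(A::'i set) r f g. directed_set A r \<and> (\<forall>a\<in>A. disjoint_sum e (f a) (g a)) \<and>
        order_converges A r (\<lambda>a. T (f a) - T (g a)) 0"
  shows "order_narrow T"
  unfolding order_narrow_def
proof
  fix e
  obtain A :: "'i set" and r f g u where *: "directed_set A r" "decreases_to_0 A r u"
      "\<forall>a\<in>A. disjoint_sum e (f a) (g a)" "\<forall>a\<in>A. \<bar>T (f a) - T (g a) - 0\<bar> \<le> u a"
    using assms[of e] unfolding order_converges_def by blast
  let ?c = "inv_into A u"
  have c: "?c d \<in> A" "u (?c d) = d" if "d \<in> u ` A" for d
    using that by (auto simp: inv_into_into f_inv_into_f)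
  have "\<forall>d\<in>u ` A. disjoint_sum e (f (?c d)) (g (?c d))"
    using *(3) c by blast
  moreover have "order_converges (u ` A) (\<lambda>x y. y \<le> x) (\<lambda>d. T (f (?c d)) - T (g (?c d))) 0"
    unfolding order_converges_def
  proof (intro exI conjI ballI)
    show "decreases_to_0 (u ` A) (\<lambda>x y. y \<le> x) (\<lambda>x. x)"
      by (rule directed_set_image(2)[OF *(1,2)])
    show "\<bar>T (f (?c d)) - T (g (?c d)) - 0\<bar> \<le> d" if "d \<in> u ` A" for d
      using *(4)[rule_format, OF c(1)[OF that]] c(2)[OF that] by simp
  qed
  ultimately show "\<exists>(A::'f set) r f g. directed_set A r \<and>
      (\<forall>a\<in>A. disjoint_sum e (f a) (g a)) \<and>
      order_converges A r (\<lambda>a. T (f a) - T (g a)) 0"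
    using directed_set_image(1)[OF *(1,2)]
    by (intro exI[of _ "u ` A"] exI[of _ "\<lambda>x y. y \<le> x"] exI[of _ "f \<circ> ?c"] exI[of _ "g \<circ> ?c"]) simp
qed

end

(*
  Write M for the modulus of T and measure everything in the norm of the Banach lattice: order
  narrowness becomes the existence of splittings e = f + g with T f - T g small in norm, because
  intervals of F are intervals of the Banach lattice and its norm is order continuous.

  M e is the norm limit of the sums of the |T e_i| over finite disjoint decompositions of e. If T is
  narrow, every piece e_i can be split into two parts on which |T| is nearly equal; collecting the
  parts nearly halves M e.

  Conversely, let M be narrow. Choose a positive functional phi that controls the norm on [0, M e].
  Halve e repeatedly with respect to M, and combine differences z1, z2 belonging to the two halves:
  the better of z1 + z2 and z1 - z2 has phi-mean at most phi (sup |z1| |z2|). So either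
  phi (inf |z1| |z2|) is gained, or |z1| + |z2| is close to sup |z1| |z2|; if the latter happens
  throughout n halvings, the resulting difference is dominated by about M e / 2^n.
*)
theory Submission
  imports Defs
begin

section \<open>Disjointness and fragments\<close>

text \<open>A splitting that is balanced for M says little about T: if M f is close to M g, there
  still remains only the bound M e for |T f - T g|. What can be exploited is freedom of sign:
  exchanging the two parts of a piece negates its difference, so differences of disjoint pieces may
  be added with either sign. Signs cancel only where the differences overlap, and differences with
  disjoint moduli gain nothing in the mean; this is why a pointwise bound has to be carried along
  with the mean. The gain is measured by a linear functional because a gain on one piece must
  survive the addition of the others, and a lattice norm need not register it. The functional may
  depend on e: no single one need control the norm on all order intervals.\<close>

lemma pprt_diff:
  fixes u v :: "'a::vector_lattice"
  assumes "inf u v = 0"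
  shows "pprt (u - v) = u"
proof -
  have "pprt (u - v) = sup u v - v"
    using add_sup_distrib_right[of u v "- v"] by (simp add: pprt_def)
  then show ?thesis
    using add_eq_inf_sup[of u v] assms by (metis add.right_neutral add_diff_cancel_right')
qed

lemma inf_pprt_uminus: "inf (pprt x) (pprt (- x)) = (0::'a::vector_lattice)"
proof -
  have "inf (pprt x) (pprt (- x)) = inf (x + pprt (- x)) (0 + pprt (- x))"
    using prts[of x] pprt_neg[of x] by (metis add.left_neutral add_diff_cancel_right' diff_add_cancel diff_minus_eq_add)
  also have "\<dots> = nprt x + pprt (- x)"
    by (simp only: nprt_def flip: add_inf_distrib_right)
  finally show ?thesis
    by (simp add: pprt_neg)
qed

lemma abs_eq_pprt_add: "\<bar>x\<bar> = pprt x + pprt (- x)" for x :: "'a::vector_lattice"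
  by (simp add: abs_prts pprt_neg)

lemma eq_pprt_diff: "x = pprt x - pprt (- x)" for x :: "'a::vector_lattice"
  using prts[of x] by (simp add: pprt_neg)

lemma inf_add_le:
  fixes a b c :: "'a::vector_lattice"
  assumes "0 \<le> a" "0 \<le> b" "0 \<le> c"
  shows "inf (a + b) c \<le> inf a c + inf b c"
proof -
  \<comment> \<open>The right-hand side distributes into the infimum of \<open>a + b\<close>,
    \<open>a + c\<close>, \<open>c + b\<close> and \<open>c + c\<close>; these are the bounds that
    are not immediate.\<close>
  have "inf (a + b) c \<le> a + c" "inf (a + b) c \<le> c + b" "inf (a + b) c \<le> c + c"
    using assms by (auto intro: le_infI2 add_increasing add_increasing2)
  then show ?thesis
    by (simp add: add_inf_distrib_left add_inf_distrib_right)
qed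

lemma lat_disjoint_sym: "lat_disjoint x y \<Longrightarrow> lat_disjoint y x"
  by (simp add: lat_disjoint_def inf_commute)

lemma lat_disjoint_mono:
  assumes "lat_disjoint x y" "\<bar>x'\<bar> \<le> \<bar>x\<bar>" "\<bar>y'\<bar> \<le> \<bar>y\<bar>"
  shows "lat_disjoint x' y'"
proof -
  have "inf \<bar>x'\<bar> \<bar>y'\<bar> \<le> 0"
    using inf_mono[OF assms(2,3)] assms(1) by (simp only: lat_disjoint_def)
  then show ?thesis
    unfolding lat_disjoint_def by (intro order.antisym) auto
qed

lemma lat_disjoint_add_left:
  assumes "lat_disjoint x z" "lat_disjoint y z"
  shows "lat_disjoint (x + y) z"
proof -
  have "inf \<bar>x + y\<bar> \<bar>z\<bar> \<le> inf (\<bar>x\<bar> + \<bar>y\<bar>) \<bar>z\<bar>"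
    by (rule inf_mono[OF abs_triangle_ineq order.refl])
  also have "\<dots> \<le> inf \<bar>x\<bar> \<bar>z\<bar> + inf \<bar>y\<bar> \<bar>z\<bar>"
    by (rule inf_add_le) auto
  finally show ?thesis
    using assms unfolding lat_disjoint_def by (intro order.antisym) auto
qed

lemma lat_disjoint_add_right:
  "lat_disjoint z x \<Longrightarrow> lat_disjoint z y \<Longrightarrow> lat_disjoint z (x + y)"
  by (meson lat_disjoint_sym lat_disjoint_add_left)

lemma lat_disjoint_0 [simp]: "lat_disjoint x 0" "lat_disjoint 0 x"
  by (simp_all add: lat_disjoint_def inf_absorb1 inf_absorb2)

text \<open>The modulus of \<open>x + y\<close> dominates both differences of the moduli, hence
  their supremum minus their infimum; disjointness turns this into
  \<open>\<bar>x\<bar> + \<bar>y\<bar>\<close>.\<close>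

lemma abs_le_abs_add_disjoint:
  assumes "lat_disjoint x y"
  shows "\<bar>x\<bar> \<le> \<bar>x + y\<bar>"
proof -
  have "sup \<bar>x\<bar> \<bar>y\<bar> = \<bar>x\<bar> + \<bar>y\<bar>"
    using add_eq_inf_sup[of "\<bar>x\<bar>" "\<bar>y\<bar>"] assms by (simp add: lat_disjoint_def)
  moreover have "\<bar>x\<bar> - \<bar>y\<bar> \<le> \<bar>x + y\<bar>" "\<bar>y\<bar> - \<bar>x\<bar> \<le> \<bar>x + y\<bar>"
    using abs_triangle_ineq2[of x "- y"] abs_triangle_ineq2[of y "- x"] by (simp_all add: add.commute)
  then have "sup \<bar>x\<bar> \<bar>y\<bar> \<le> \<bar>x + y\<bar> + inf \<bar>x\<bar> \<bar>y\<bar>"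
    by (simp add: add_inf_distrib_left algebra_simps add_increasing)
  ultimately have "\<bar>x\<bar> + \<bar>y\<bar> \<le> \<bar>x + y\<bar>"
    using assms by (simp add: lat_disjoint_def)
  then show ?thesis
    by (meson abs_ge_zero add_increasing2 order_refl order_trans)
qed

lemma disjoint_sum_abs_le:
  assumes "disjoint_sum e f g"
  shows "\<bar>f\<bar> \<le> \<bar>e\<bar>" "\<bar>g\<bar> \<le> \<bar>e\<bar>"
  using assms abs_le_abs_add_disjoint[of f g] abs_le_abs_add_disjoint[of g f]
  by (auto simp: disjoint_sum_def add.commute lat_disjoint_sym)

lemma disjoint_sum_sym: "disjoint_sum e f g \<Longrightarrow> disjoint_sum e g f"
  by (auto simp: disjoint_sum_def add.commute lat_disjoint_sym)

lemma disjoint_sum_0 [simp]: "disjoint_sum e e 0"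
  by (simp add: disjoint_sum_def)

text \<open>The sum of the positive parts is disjoint from the sum of the negative parts, and a
  difference of disjoint positive elements determines its positive part
  (\<open>pprt_diff\<close>).\<close>

lemma pprt_add_disjoint:
  assumes "lat_disjoint x y"
  shows "pprt (x + y) = pprt x + pprt y"
proof -
  have le: "\<bar>pprt z\<bar> \<le> \<bar>z\<bar>" "\<bar>pprt (- z)\<bar> \<le> \<bar>z\<bar>" for z :: 'a
    by (auto simp: abs_eq_pprt_add[of z])
  have self: "lat_disjoint (pprt z) (pprt (- z))" for z :: 'a
    by (simp add: lat_disjoint_def inf_pprt_uminus)
  have "lat_disjoint (pprt x + pprt y) (pprt (- x) + pprt (- y))"
    using assms lat_disjoint_sym[OF assms]
    by (intro lat_disjoint_add_left lat_disjoint_add_right self) (auto elim: lat_disjoint_mono intro: le)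
  then have "pprt ((pprt x + pprt y) - (pprt (- x) + pprt (- y))) = pprt x + pprt y"
    by (intro pprt_diff) (simp add: lat_disjoint_def)
  moreover have "(pprt x + pprt y) - (pprt (- x) + pprt (- y)) = x + y"
    unfolding add_diff_add by (simp only: flip: eq_pprt_diff)
  ultimately show ?thesis by simp
qed

lemma eq_inf_add_inf:
  fixes x y z :: "'a::vector_lattice"
  assumes "0 \<le> x" "0 \<le> y" "0 \<le> z" "inf y z = 0" "x \<le> y + z"
  shows "x = inf x y + inf x z"
proof (rule order.antisym)
  have "x = inf (y + z) x"
    using assms(5) by (simp add: inf_absorb2)
  also have "\<dots> \<le> inf x y + inf x z"
    using inf_add_le[OF assms(2,3,1)] by (simp add: inf_commute)
  finally show "x \<le> inf x y + inf x z" .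
  have "inf (inf x y) (inf x z) \<le> inf y z"
    by (simp add: le_infI1 le_infI2)
  then have "inf (inf x y) (inf x z) = 0"
    using assms by (intro order.antisym) auto
  then have "inf x y + inf x z = sup (inf x y) (inf x z)"
    by (subst add_eq_inf_sup) simp
  then show "inf x y + inf x z \<le> x"
    by simp
qed

text \<open>Two decompositions of one element are cut against each other: Riesz decomposition within
  the Boolean algebra of fragments, for elements of arbitrary sign.\<close>

lemma common_refinement:
  fixes x1 x2 y z :: "'a::vector_lattice"
  assumes "lat_disjoint x1 x2" "lat_disjoint y z" "x1 + x2 = y + z"
  obtains a b c d where
    "disjoint_sum x1 a b" "disjoint_sum x2 c d" "disjoint_sum y a c" "disjoint_sum z b d"
proof -
  \<comment> \<open>The signed meet. On fragments of a common element it is their meet as fragments;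
    plain \<open>inf\<close> would be wrong on negative parts.\<close>
  define m :: "'a \<Rightarrow> 'a \<Rightarrow> 'a" where
    "m s t = inf (pprt s) (pprt t) - inf (pprt (- s)) (pprt (- t))" for s t
  have m_sym: "m s t = m t s" for s t
    by (simp add: m_def inf_commute)
  have m_le: "\<bar>m s t\<bar> \<le> \<bar>s\<bar>" for s t
  proof -
    have "\<bar>m s t\<bar> \<le> inf (pprt s) (pprt t) + inf (pprt (- s)) (pprt (- t))"
      unfolding m_def by (rule order.trans[OF abs_triangle_ineq4]) simp
    also have "\<dots> \<le> \<bar>s\<bar>"
      unfolding abs_eq_pprt_add by (intro add_mono) auto
    finally show ?thesis .
  qed
  have m_dis: "lat_disjoint (m s t) (m s t')" if "lat_disjoint t t'" for s t t'
    using lat_disjoint_mono[OF that] m_le by (simp add: m_sym[of s])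
  have m_add: "s = m s t + m s t'" if st: "lat_disjoint s s'" "lat_disjoint t t'" "s + s' = t + t'"
    for s s' t t'
  proof -
    have p: "pprt s = inf (pprt s) (pprt t) + inf (pprt s) (pprt t')"
      if "lat_disjoint s s'" "lat_disjoint t t'" "s + s' = t + t'" for s s' t t' :: 'a
    proof (rule eq_inf_add_inf)
      have "lat_disjoint (pprt t) (pprt t')"
        by (rule lat_disjoint_mono[OF that(2)]) (auto simp: abs_eq_pprt_add[of t] abs_eq_pprt_add[of t'])
      then show "inf (pprt t) (pprt t') = 0"
        by (simp add: lat_disjoint_def)
      have "pprt s \<le> pprt s + pprt s'"
        by simp
      also have "\<dots> = pprt t + pprt t'"
        using that pprt_add_disjoint by metis
      finally show "pprt s \<le> pprt t + pprt t'" .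
    qed auto
    have neg: "lat_disjoint (- s) (- s')" "lat_disjoint (- t) (- t')"
      using st by (simp_all add: lat_disjoint_def)
    have neg_add: "- s + - s' = - t + - t'"
      by (simp only: st(3) flip: minus_add_distrib)
    have "s = pprt s - pprt (- s)"
      by (rule eq_pprt_diff)
    also have "\<dots> = m s t + m s t'"
      unfolding m_def by (subst p[OF st], subst p[OF neg neg_add]) (rule add_diff_add)
    finally show ?thesis .
  qed
  note s = assms(1) lat_disjoint_sym[OF assms(1)] assms(2) lat_disjoint_sym[OF assms(2)]
  show thesis
  proof
    show "disjoint_sum x1 (m x1 y) (m x1 z)"
      unfolding disjoint_sum_def using m_add[OF s(1,3) assms(3)] m_dis[OF s(3)] by blast
    show "disjoint_sum x2 (m x2 y) (m x2 z)"
      unfolding disjoint_sum_def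
      using m_add[OF s(2,3)] m_dis[OF s(3)] assms(3) by (simp add: add.commute)
    show "disjoint_sum y (m x1 y) (m x2 y)"
      unfolding disjoint_sum_def m_sym[of _ y]
      using m_add[OF s(3,1)] m_dis[OF s(1)] assms(3) by simp
    show "disjoint_sum z (m x1 z) (m x2 z)"
      unfolding disjoint_sum_def m_sym[of _ z]
      using m_add[OF s(4,1)] m_dis[OF s(1)] assms(3) by (simp add: add.commute)
  qed
qed

lemma disjoint_sum_disjoint:
  assumes "disjoint_sum x a b" "disjoint_sum y c d" "lat_disjoint x y"
  shows "lat_disjoint a c" "lat_disjoint a d" "lat_disjoint b c" "lat_disjoint b d"
  using assms disjoint_sum_abs_le lat_disjoint_mono by metis+

lemma disjoint_sum_add:
  assumes "disjoint_sum x a b" "disjoint_sum y c d" "lat_disjoint x y"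
  shows "disjoint_sum (x + y) (a + c) (b + d)"
  using assms disjoint_sum_disjoint[OF assms]
  by (auto simp: disjoint_sum_def algebra_simps lat_disjoint_sym
      intro!: lat_disjoint_add_left lat_disjoint_add_right)

lemma orthogonally_additiveD:
  "orthogonally_additive T \<Longrightarrow> disjoint_sum x y z \<Longrightarrow> T x = T y + T z"
  by (simp add: orthogonally_additive_def disjoint_sum_def)

lemma orthogonally_additive_0: "orthogonally_additive T \<Longrightarrow> T 0 = 0"
  unfolding orthogonally_additive_def by (metis add_0 add_cancel_right_left lat_disjoint_0(2))

text \<open>Expanding both moduli leaves four inequalities: \<open>2x\<close>, \<open>-2x\<close>,
  \<open>2y\<close> and \<open>-2y\<close> are at most twice the supremum. On the reals equality
  holds.\<close>

lemma abs_add_abs_diff_le: "\<bar>x + y\<bar> + \<bar>x - y\<bar> \<le> 2 *\<^sub>R sup \<bar>x\<bar> \<bar>y\<bar>" for x y :: "'a::vector_lattice"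
proof -
  define s where "s = sup \<bar>x\<bar> \<bar>y\<bar>"
  have s: "x \<le> s" "- x \<le> s" "y \<le> s" "- y \<le> s"
    unfolding s_def by (auto intro: le_supI1 le_supI2 abs_ge_self abs_ge_minus_self)
  have "x + y \<le> 2 *\<^sub>R s - (x - y)" "- (x + y) \<le> 2 *\<^sub>R s - (x - y)"
      "x + y \<le> 2 *\<^sub>R s - - (x - y)" "- (x + y) \<le> 2 *\<^sub>R s - - (x - y)"
    using add_mono[OF s(1) s(1)] add_mono[OF s(2) s(2)] add_mono[OF s(3) s(3)] add_mono[OF s(4) s(4)]
    by (simp_all add: scaleR_2 algebra_simps)
  then have "x - y \<le> 2 *\<^sub>R s - \<bar>x + y\<bar>" "- (x - y) \<le> 2 *\<^sub>R s - \<bar>x + y\<bar>"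
    by (metis abs_leI le_diff_eq add.commute)+
  then have "\<bar>x - y\<bar> \<le> 2 *\<^sub>R s - \<bar>x + y\<bar>"
    by (rule abs_leI)
  then show ?thesis
    unfolding s_def le_diff_eq by (simp only: add.commute)
qed

section \<open>Order continuous norms\<close>

lemma norm_mono_nonneg:
  fixes x y :: "'a::banach_lattice"
  assumes "0 \<le> x" "x \<le> y"
  shows "norm x \<le> norm y"
  using assms by (intro norm_mono_abs) (metis abs_of_nonneg order_trans)

lemma norm_abs [simp]: "norm \<bar>x\<bar> = norm x" for x :: "'a::banach_lattice"
  by (intro order.antisym norm_mono_abs) auto

lemma norm_pprt_le: "norm (pprt x) \<le> norm x" for x :: "'a::banach_lattice"
  by (intro norm_mono_abs) (simp add: abs_eq_pprt_add[of x])

text \<open>The positive part of \<open>x\<close> lies between 0 and that of \<open>w\<close>, so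
  its norm vanishes. This closedness of the cone turns norm approximation into order
  inequalities.\<close>

lemma le_0_if_le_small:
  fixes x :: "'a::banach_lattice"
  assumes "\<And>\<epsilon>. \<epsilon> > 0 \<Longrightarrow> \<exists>w. x \<le> w \<and> norm w < \<epsilon>"
  shows "x \<le> 0"
proof -
  have "norm (pprt x) \<le> \<epsilon>" if "\<epsilon> > 0" for \<epsilon>
  proof -
    from assms[OF that] obtain w where "x \<le> w" "norm w < \<epsilon>" by blast
    moreover from this have "norm (pprt x) \<le> norm (pprt w)"
      by (intro norm_mono_nonneg pprt_mono) auto
    ultimately show ?thesis
      using norm_pprt_le[of w] by linarith
  qed
  then have "norm (pprt x) \<le> 0"
    by (rule field_le_epsilon) simp
  then show ?thesis
    by (simp add: le_zero_iff_zero_pprt)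
qed

lemma le_0_if_multiples_bounded:
  fixes x :: "'a::banach_lattice"
  assumes "\<And>n::nat. of_nat n *\<^sub>R x \<le> v"
  shows "x \<le> 0"
proof (rule le_0_if_le_small)
  fix \<epsilon> :: real
  assume "\<epsilon> > 0"
  obtain n :: nat where n: "norm v / \<epsilon> < n"
    using reals_Archimedean2 by blast
  then have "real n > 0"
    using \<open>\<epsilon> > 0\<close> by (metis divide_nonneg_pos norm_ge_zero order_le_less_trans)
  then have "x \<le> v /\<^sub>R n"
    using assms[of n] by (simp add: pos_le_divideR_eq)
  moreover have "norm (v /\<^sub>R n) < \<epsilon>"
    using n \<open>real n > 0\<close> \<open>\<epsilon> > 0\<close> by (simp add: field_simps)
  ultimately show "\<exists>w. x \<le> w \<and> norm w < \<epsilon>" by blast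
qed

text \<open>Order continuity speaks only of nets decreasing to 0, while no supremum of
  \<open>D\<close> is known yet. The net of all \<open>b - d\<close>, with \<open>b\<close> an upper
  bound and \<open>d\<close> in \<open>D\<close>, avoids naming it; its smallness makes suitable
  \<open>d\<close> Cauchy, and their limit is the supremum.\<close>

lemma directed_Sup_exists:
  fixes D :: "'a::banach_lattice set"
  assumes ocn: "order_continuous_norm TYPE('a)"
    and "D \<noteq> {}"
    and dir: "\<And>a b. a \<in> D \<Longrightarrow> b \<in> D \<Longrightarrow> \<exists>c\<in>D. a \<le> c \<and> b \<le> c"
    and bdd: "\<And>d. d \<in> D \<Longrightarrow> d \<le> v"
  shows "\<exists>s. (\<forall>d\<in>D. d \<le> s) \<and> (\<forall>b. (\<forall>d\<in>D. d \<le> b) \<longrightarrow> s \<le> b) \<and>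
    (\<forall>\<epsilon>>0. \<exists>d\<in>D. norm (s - d) < \<epsilon>)"
proof -
  define B where "B = {b. \<forall>d\<in>D. d \<le> b}"
  define r where "r p q \<longleftrightarrow> fst q \<le> fst p \<and> snd p \<le> snd q" for p q :: "'a \<times> 'a"
  have "v \<in> B"
    using bdd by (simp add: B_def)
  have directed: "directed_set (B \<times> D) r"
    unfolding directed_set_def
  proof (intro conjI ballI impI)
    show "B \<times> D \<noteq> {}"
      using \<open>v \<in> B\<close> \<open>D \<noteq> {}\<close> by auto
    show "r a a" for a
      by (simp add: r_def)
    show "r a c" if "r a b" "r b c" for a b c
      using that by (auto simp: r_def)
    show "\<exists>c\<in>B \<times> D. r p c \<and> r q c" if pq: "p \<in> B \<times> D" "q \<in> B \<times> D" for p q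
    proof -
      obtain c where "c \<in> D" "snd p \<le> c" "snd q \<le> c"
        using dir[of "snd p" "snd q"] pq by auto
      moreover have "inf (fst p) (fst q) \<in> B"
        using pq by (auto simp: B_def)
      ultimately show ?thesis
        by (intro bexI[of _ "(inf (fst p) (fst q), c)"]) (auto simp: r_def)
    qed
  qed
  have "w \<le> 0" if w: "\<And>b d. b \<in> B \<Longrightarrow> d \<in> D \<Longrightarrow> w \<le> b - d" for w
  proof -
    obtain d where d: "d \<in> D"
      using \<open>D \<noteq> {}\<close> by blast
    \<comment> \<open>A lower bound \<open>w\<close> of all \<open>b - d\<close> can be subtracted
      from any upper bound of \<open>D\<close> and leaves an upper bound, so all multiples of
      \<open>w\<close> stay below \<open>v - d\<close>.\<close>
    have "v - real n *\<^sub>R w \<in> B" for n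
    proof (induction n)
      case (Suc n)
      have "d \<le> v - real n *\<^sub>R w - w" if "d \<in> D" for d
        using w[OF Suc that] by (simp add: algebra_simps)
      then show ?case
        by (simp add: B_def algebra_simps)
    qed (use \<open>v \<in> B\<close> in simp)
    then have "real n *\<^sub>R w \<le> v - d" for n
      using d by (simp add: B_def algebra_simps)
    then show ?thesis
      by (rule le_0_if_multiples_bounded)
  qed
  then have "decreases_to_0 (B \<times> D) r (\<lambda>p. fst p - snd p)"
    unfolding decreases_to_0_def by (fastforce simp: r_def B_def intro: diff_mono)
  note small = order_continuous_normD[OF ocn directed this]
  have "\<exists>b d. b \<in> B \<and> d \<in> D \<and> norm (b - d) < 1 / real (Suc n)" for n
  proof -
    obtain p where "p \<in> B \<times> D" "\<forall>q\<in>B \<times> D. r p q \<longrightarrow> norm (fst q - snd q) < 1 / real (Suc n)"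
      using small[of "1 / real (Suc n)"] by auto
    moreover have "r p p"
      by (simp add: r_def)
    ultimately show ?thesis
      by (cases p) auto
  qed
  then obtain b d where bd: "\<And>n. b n \<in> B" "\<And>n. d n \<in> D"
    and lt: "\<And>n. norm (b n - d n) < 1 / real (Suc n)"
    by metis
  have pos: "d m \<le> b n" for m n
    using bd unfolding B_def by blast
  have "norm (d n - d m) < 1 / real (Suc n) + 1 / real (Suc m)" for n m
  proof -
    have "\<bar>d n - d m\<bar> \<le> (b n - d n) + (b m - d m)"
    proof (rule abs_leI)
      show "d n - d m \<le> (b n - d n) + (b m - d m)"
        using add_mono[OF pos[of n m] pos[of n n]] by (simp add: algebra_simps)
      show "- (d n - d m) \<le> (b n - d n) + (b m - d m)"
        using add_mono[OF pos[of m n] pos[of m m]] by (simp add: algebra_simps)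
    qed
    then have "norm (d n - d m) \<le> norm ((b n - d n) + (b m - d m))"
      by (intro norm_mono_abs) (meson abs_ge_self order_trans)
    then show ?thesis
      using norm_triangle_ineq[of "b n - d n" "b m - d m"] lt[of n] lt[of m] by linarith
  qed
  note cauchy = this
  have "Cauchy d"
  proof (rule CauchyI)
    fix e :: real
    assume "e > 0"
    then obtain N where N: "1 / real (Suc N) < e / 2"
      using nat_approx_posE[of "e / 2"] by auto
    have "norm (d m - d n) < e" if "m \<ge> N" "n \<ge> N" for m n
    proof -
      have "1 / real (Suc m) \<le> 1 / real (Suc N)" "1 / real (Suc n) \<le> 1 / real (Suc N)"
        using that by (auto intro!: divide_left_mono)
      then show ?thesis
        using cauchy[of m n] N by linarith
    qed
    then show "\<exists>M. \<forall>m\<ge>M. \<forall>n\<ge>M. norm (d m - d n) < e" by blast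
  qed
  then obtain s where "d \<longlonglongrightarrow> s"
    using Cauchy_convergent_iff convergent_def by blast
  then have lim: "(\<lambda>n. norm (d n - s)) \<longlonglongrightarrow> 0"
    by (intro tendsto_norm_zero LIM_zero)
  have approx: "\<exists>n. norm (d n - s) < e \<and> norm (b n - d n) < e" if "e > 0" for e
  proof -
    obtain M where M: "1 / real (Suc M) < e"
      using nat_approx_posE[OF \<open>e > 0\<close>] by auto
    obtain N where N: "\<And>n. n \<ge> N \<Longrightarrow> norm (d n - s) < e"
      using lim \<open>e > 0\<close> unfolding LIMSEQ_iff by auto
    have "1 / real (Suc (max M N)) \<le> 1 / real (Suc M)"
      by (auto intro!: divide_left_mono)
    then have "norm (b (max M N) - d (max M N)) < e"
      using lt[of "max M N"] M by linarith
    then show ?thesis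
      using N[of "max M N"] by auto
  qed
  show ?thesis
  proof (intro exI[of _ s] conjI allI ballI impI)
    fix x
    assume "x \<in> D"
    have "x - s \<le> 0"
    proof (rule le_0_if_le_small)
      fix e :: real
      assume "e > 0"
      then obtain n where n: "norm (d n - s) < e / 2" "norm (b n - d n) < e / 2"
        using approx[of "e / 2"] by auto
      have "x - s \<le> b n - s"
        using bd(1)[of n] \<open>x \<in> D\<close> by (simp add: B_def)
      moreover have "norm (b n - s) < e"
        using n norm_triangle_ineq[of "b n - d n" "d n - s"] by simp
      ultimately show "\<exists>w. x - s \<le> w \<and> norm w < e" by blast
    qed
    then show "x \<le> s" by simp
  next
    fix c
    assume c: "\<forall>x\<in>D. x \<le> c"
    have "s - c \<le> 0"
    proof (rule le_0_if_le_small)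
      fix e :: real
      assume "e > 0"
      then obtain n where n: "norm (d n - s) < e"
        using approx by auto
      have "s - c \<le> s - d n"
        using c bd(2) by simp
      with n show "\<exists>w. s - c \<le> w \<and> norm w < e"
        by (metis norm_minus_commute)
    qed
    then show "s \<le> c" by simp
  next
    show "\<exists>x\<in>D. norm (s - x) < e" if "e > 0" for e
      using approx[OF that] bd(2) by (metis norm_minus_commute)
  qed
qed


section \<open>Positive functionals\<close>

definition sublinear :: "('v::real_vector \<Rightarrow> real) \<Rightarrow> bool" where
  "sublinear q \<longleftrightarrow> (\<forall>x y. q (x + y) \<le> q x + q y) \<and> (\<forall>c>0. \<forall>x. q (c *\<^sub>R x) = c * q x)"

lemma sublinearI:
  assumes "\<And>x y. q (x + y) \<le> q x + q y" "\<And>c x. c > 0 \<Longrightarrow> q (c *\<^sub>R x) \<le> c * q x"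
  shows "sublinear q"
proof -
  have "q (c *\<^sub>R x) = c * q x" if "c > 0" for c x
    using assms(2)[OF that, of x] assms(2)[of "inverse c" "c *\<^sub>R x"] that by (simp add: field_simps)
  then show ?thesis
    using assms(1) by (simp add: sublinear_def)
qed

lemma sublinear_add: "sublinear q \<Longrightarrow> q (x + y) \<le> q x + q y"
  by (simp add: sublinear_def)

lemma sublinear_scaleR: "sublinear q \<Longrightarrow> c > 0 \<Longrightarrow> q (c *\<^sub>R x) = c * q x"
  by (simp add: sublinear_def)

lemma sublinear_0: "sublinear q \<Longrightarrow> q 0 = 0"
  using sublinear_scaleR[of q 2 0] by simp

lemma sublinear_scaleR': "sublinear q \<Longrightarrow> c \<ge> 0 \<Longrightarrow> q (c *\<^sub>R x) = c * q x"
  by (cases "c = 0") (auto simp: sublinear_0 sublinear_scaleR)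

lemma sublinear_uminus: "sublinear q \<Longrightarrow> - q (- x) \<le> q x"
  using sublinear_add[of q x "- x"] sublinear_0[of q] by simp

text \<open>If \<open>q\<close> is minimal among sublinear functionals, the minorant equals
  \<open>q\<close> and forces \<open>q (- y) = - q y\<close>: minimality yields oddness and with it
  linearity.\<close>

lemma sublinear_minorant:
  assumes q: "sublinear q"
  obtains q' where "sublinear q'" "\<And>x. q' x \<le> q x" "q' (- y) \<le> - q y"
proof
  \<comment> \<open>The parameter \<open>t = 0\<close> gives the comparison with \<open>q\<close>,
    and \<open>t = 1\<close> the value at \<open>- y\<close>. Subadditivity keeps the infimum above
    \<open>- q (- x)\<close>.\<close>
  define q' where "q' x = (INF t\<in>{0..}. q (x + t *\<^sub>R y) - t * q y)" for x
  have bdd: "bdd_below ((\<lambda>t. q (x + t *\<^sub>R y) - t * q y) ` {0..})" for x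
  proof (rule bdd_belowI2)
    fix t :: real
    assume "t \<in> {0..}"
    then show "- q (- x) \<le> q (x + t *\<^sub>R y) - t * q y"
      using sublinear_add[OF q, of "x + t *\<^sub>R y" "- x"] sublinear_scaleR'[OF q, of t y] by simp
  qed
  have q'_le: "q' x \<le> q (x + t *\<^sub>R y) - t * q y" if "t \<ge> 0" for x t
    unfolding q'_def using that by (intro cINF_lower bdd) auto
  show "q' x \<le> q x" for x
    using q'_le[of 0 x] by simp
  show "q' (- y) \<le> - q y"
    using q'_le[of 1 "- y"] sublinear_0[OF q] by simp
  show "sublinear q'"
  proof (rule sublinearI)
    fix x z
    have "q' (x + z) - (q (z + t *\<^sub>R y) - t * q y) \<le> q' x" if t: "t \<ge> 0" for t
      unfolding q'_def[of x]
    proof (rule cINF_greatest)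
      fix s :: real
      assume "s \<in> {0..}"
      then have "q' (x + z) \<le> q (x + z + (s + t) *\<^sub>R y) - (s + t) * q y"
        using t by (intro q'_le) auto
      also have "q (x + z + (s + t) *\<^sub>R y) \<le> q (x + s *\<^sub>R y) + q (z + t *\<^sub>R y)"
        using sublinear_add[OF q, of "x + s *\<^sub>R y" "z + t *\<^sub>R y"] by (simp add: algebra_simps)
      finally show "q' (x + z) - (q (z + t *\<^sub>R y) - t * q y) \<le> q (x + s *\<^sub>R y) - s * q y"
        by (simp add: algebra_simps)
    qed simp
    then have "q' (x + z) - q' x \<le> q' z"
      unfolding q'_def[of z] by (intro cINF_greatest) (auto simp: algebra_simps)
    then show "q' (x + z) \<le> q' x + q' z" by simp
  next
    fix c :: real and x
    assume c: "c > 0"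
    have "q' (c *\<^sub>R x) / c \<le> q' x"
      unfolding q'_def[of x]
    proof (rule cINF_greatest)
      fix t :: real
      assume "t \<in> {0..}"
      then have "q' (c *\<^sub>R x) \<le> q (c *\<^sub>R (x + t *\<^sub>R y)) - c * t * q y"
        using q'_le[of "c * t" "c *\<^sub>R x"] c by (simp add: algebra_simps)
      then show "q' (c *\<^sub>R x) / c \<le> q (x + t *\<^sub>R y) - t * q y"
        unfolding sublinear_scaleR[OF q c] using c by (simp add: field_simps)
    qed simp
    then show "q' (c *\<^sub>R x) \<le> c * q' x"
      using c by (simp add: field_simps)
  qed
qed

text \<open>A minimal sublinear functional is linear.\<close>

lemma Hahn_Banach_sublinear:
  fixes p :: "'v::real_vector \<Rightarrow> real"
  assumes "sublinear p"
  obtains \<psi> where "linear \<psi>" "\<And>x. \<psi> x \<le> p x" "\<psi> y = p y"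
proof -
  \<comment> \<open>Zorn's lemma is run below \<open>p'\<close> instead of \<open>p\<close>: a
    linear functional below \<open>p'\<close> is at most \<open>- p y\<close> at \<open>- y\<close>,
    hence attains \<open>p y\<close> at \<open>y\<close>.\<close>
  obtain p' where p': "sublinear p'" "\<And>x. p' x \<le> p x" "p' (- y) \<le> - p y"
    using sublinear_minorant[OF assms] by blast
  define A where "A = {q. sublinear q \<and> (\<forall>x. q x \<le> p' x)}"
  define P :: "('v \<Rightarrow> real) \<Rightarrow> ('v \<Rightarrow> real) \<Rightarrow> bool" where "P q q' \<longleftrightarrow> q' \<le> q" for q q'
  have "\<exists>m\<in>A. \<forall>a\<in>A. P m a \<longrightarrow> a = m"
  proof (rule predicate_Zorn)
    show "partial_order_on A (relation_of P A)"
      by (auto simp: P_def intro!: partial_order_on_relation_ofI)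
    fix C
    assume "C \<in> Chains (relation_of P A)"
    then have C: "C \<subseteq> A" and chain: "\<And>a b. a \<in> C \<Longrightarrow> b \<in> C \<Longrightarrow> a \<le> b \<or> b \<le> a"
      by (auto simp: Chains_def relation_of_def P_def)
    show "\<exists>u\<in>A. \<forall>a\<in>C. P a u"
    proof (cases "C = {}")
      case True
      then show ?thesis
        using p' by (auto simp: A_def)
    next
      case False
      define u where "u x = (INF q\<in>C. q x)" for x
      have bdd: "bdd_below ((\<lambda>q. q x) ` C)" for x
      proof (rule bdd_belowI2)
        fix q
        assume "q \<in> C"
        then have "sublinear q" "q (- x) \<le> p' (- x)"
          using C by (auto simp: A_def)
        then show "- p' (- x) \<le> q x"
          using sublinear_uminus[of q x] by simp
      qed
      have u_le: "u x \<le> q x" if "q \<in> C" for q x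
        unfolding u_def using that by (intro cINF_lower bdd)
      have "sublinear u"
      proof (rule sublinearI)
        fix x z
        have "u (x + z) - q z \<le> u x" if q: "q \<in> C" for q
          unfolding u_def[of x]
        proof (rule cINF_greatest)
          fix q'
          assume q': "q' \<in> C"
          then obtain q'' where q'': "q'' \<in> C" "q'' \<le> q" "q'' \<le> q'"
            using chain[OF q q'] q by blast
          then have "sublinear q''"
            using C by (auto simp: A_def)
          then have "u (x + z) \<le> q'' x + q'' z"
            using u_le[OF q''(1), of "x + z"] sublinear_add[of q'' x z] by simp
          also have "\<dots> \<le> q' x + q z"
            using q'' by (auto simp: le_fun_def intro: add_mono)
          finally show "u (x + z) - q z \<le> q' x" by simp
        qed (use False in simp)
        then have "u (x + z) - u x \<le> u z"
          unfolding u_def[of z] using False by (intro cINF_greatest) (auto simp: algebra_simps)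
        then show "u (x + z) \<le> u x + u z" by simp
      next
        fix c :: real and x
        assume c: "c > 0"
        have "u (c *\<^sub>R x) / c \<le> u x"
          unfolding u_def[of x]
        proof (rule cINF_greatest)
          fix q
          assume "q \<in> C"
          then show "u (c *\<^sub>R x) / c \<le> q x"
            using u_le[of q "c *\<^sub>R x"] C c by (auto simp: A_def sublinear_scaleR field_simps)
        qed (use False in simp)
        then show "u (c *\<^sub>R x) \<le> c * u x"
          using c by (simp add: field_simps)
      qed
      moreover have "u x \<le> p' x" for x
      proof -
        from False obtain q where "q \<in> C" by blast
        then have "u x \<le> q x" "q x \<le> p' x"
          using u_le C by (auto simp: A_def)
        then show ?thesis by simp
      qed
      ultimately show ?thesis
        using u_le by (auto simp: A_def P_def le_fun_def)
    qed
  qed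
  then obtain m where "m \<in> A" and m_min: "\<And>q. q \<in> A \<Longrightarrow> q \<le> m \<Longrightarrow> q = m"
    unfolding P_def by blast
  then have m: "sublinear m" "\<And>x. m x \<le> p' x"
    by (auto simp: A_def)
  have min: "q = m" if "sublinear q" "q \<le> m" for q
    using that m(2) by (intro m_min) (auto simp: A_def le_fun_def intro: order_trans)
  have neg: "m (- x) = - m x" for x
  proof -
    obtain q where "sublinear q" "\<And>z. q z \<le> m z" "q (- x) \<le> - m x"
      using sublinear_minorant[OF m(1), of x] by blast
    then show ?thesis
      using min[of q] sublinear_uminus[OF m(1), of x] by (auto simp: le_fun_def)
  qed
  have "linear m"
  proof (rule linearI)
    show "m (x + z) = m x + m z" for x z
      using sublinear_add[OF m(1), of x z] sublinear_add[OF m(1), of "x + z" "- z"] neg[of z] by simp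
    show "m (c *\<^sub>R x) = c *\<^sub>R m x" for c x
      using sublinear_scaleR'[OF m(1), of c x] sublinear_scaleR'[OF m(1), of "- c" x] neg[of "c *\<^sub>R x"]
      by (cases "c \<ge> 0") auto
  qed
  moreover have "m x \<le> p x" for x
    using m(2) p'(2) order_trans by blast
  moreover have "m y = p y"
    using \<open>m y \<le> p y\<close> neg[of y] m(2)[of "- y"] p'(3) by simp
  ultimately show thesis
    using that by blast
qed

definition positive_functional :: "('a::banach_lattice \<Rightarrow> real) \<Rightarrow> bool" where
  "positive_functional \<phi> \<longleftrightarrow> bounded_linear \<phi> \<and> (\<forall>x\<ge>0. 0 \<le> \<phi> x)"

lemma positive_functional_linear: "positive_functional \<phi> \<Longrightarrow> linear \<phi>"
  by (simp add: positive_functional_def bounded_linear.linear)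

lemma positive_functional_mono:
  assumes "positive_functional \<phi>" "x \<le> y"
  shows "\<phi> x \<le> \<phi> y"
  using assms linear_diff[OF positive_functional_linear[OF assms(1)], of y x]
  by (auto simp: positive_functional_def dest: spec[of _ "y - x"])

lemma scaleR_pprt:
  fixes x :: "'a::vector_lattice"
  assumes "c > 0"
  shows "pprt (c *\<^sub>R x) = c *\<^sub>R pprt x"
proof (rule order.antisym)
  have le: "pprt (d *\<^sub>R z) \<le> d *\<^sub>R pprt z" if "d > 0" for d and z :: 'a
  proof -
    have "d *\<^sub>R z \<le> d *\<^sub>R pprt z" "0 \<le> d *\<^sub>R pprt z"
      using that by (auto simp: pprt_def intro!: scaleR_left_mono scaleR_nonneg_nonneg)
    then show ?thesis
      by (simp add: pprt_def[of "d *\<^sub>R z"])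
  qed
  show "pprt (c *\<^sub>R x) \<le> c *\<^sub>R pprt x"
    by (rule le[OF assms])
  show "c *\<^sub>R pprt x \<le> pprt (c *\<^sub>R x)"
    using le[of "inverse c" "c *\<^sub>R x"] assms scaleR_left_mono[of _ _ c] by fastforce
qed

text \<open>Hahn-Banach is applied to the norm of the positive part instead of the norm: this
  majorant vanishes at \<open>- x\<close> for positive \<open>x\<close>, which makes the functional
  positive.\<close>

lemma norming_positive_functional:
  fixes y :: "'a::banach_lattice"
  assumes "0 \<le> y"
  obtains \<psi> where "positive_functional \<psi>" "\<And>x. \<psi> x \<le> norm x" "\<psi> y = norm y"
proof -
  have "sublinear (\<lambda>x::'a. norm (pprt x))"
  proof (rule sublinearI)
    fix x z :: 'a
    have "pprt (x + z) \<le> pprt x + pprt z"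
      unfolding pprt_def by (rule le_supI) (auto intro: add_mono add_nonneg_nonneg)
    then have "norm (pprt (x + z)) \<le> norm (pprt x + pprt z)"
      by (rule norm_mono_nonneg[rotated]) simp
    then show "norm (pprt (x + z)) \<le> norm (pprt x) + norm (pprt z)"
      using norm_triangle_ineq order_trans by blast
  qed (simp add: scaleR_pprt)
  then obtain \<psi> where \<psi>: "linear \<psi>" "\<And>x. \<psi> x \<le> norm (pprt x)" "\<psi> y = norm (pprt y)"
    using Hahn_Banach_sublinear[of "\<lambda>x. norm (pprt x)" y] by auto
  have le: "\<psi> x \<le> norm x" for x
    using \<psi>(2)[of x] norm_pprt_le[of x] by linarith
  have "bounded_linear \<psi>"
    using \<psi>(1) le linear_neg[OF \<psi>(1)]
    by (intro bounded_linear_intro[where K = 1])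
      (auto simp: linear_add linear_scale abs_le_iff, metis norm_minus_cancel)
  moreover have "0 \<le> \<psi> x" if "0 \<le> x" for x
    using \<psi>(2)[of "- x"] that linear_neg[OF \<psi>(1), of x] by simp
  moreover have "\<psi> y = norm y"
    using \<psi>(3) assms by simp
  ultimately show thesis
    using that[OF _ le] by (simp add: positive_functional_def)
qed

lemma sum_half_powers_le: "(\<Sum>i\<in>{k..<m}. (1/2) ^ Suc i) \<le> (1::real)"
proof -
  have "(\<Sum>i\<in>{k..<m}. (1/2) ^ Suc i) \<le> (\<Sum>i<m. (1/2::real) ^ Suc i)"
    by (intro sum_mono2) auto
  also have "\<dots> = 1 - (1/2) ^ m"
    by (induction m) auto
  finally show ?thesis
    using zero_le_power[of "1/2::real" m] by linarith
qed

text \<open>If no functional controls the norm on \<open>{0..u}\<close>, successive norming functionals \<open>\<psi> i\<close> of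
  elements \<open>y i\<close> that are almost invisible to the earlier ones prevent the decreasing sequence
  \<open>W k\<close>, the supremum of the truncated sums of the \<open>y i\<close> with \<open>i \<ge> k\<close>, from being norm Cauchy.\<close>

lemma norm_controlling_functional:
  fixes u :: "'a::banach_lattice"
  assumes ocn: "order_continuous_norm TYPE('a)" and "0 \<le> u" "\<epsilon> > 0"
  obtains \<phi> \<delta> where "positive_functional \<phi>" "\<delta> > 0"
    "\<And>y. 0 \<le> y \<Longrightarrow> y \<le> u \<Longrightarrow> \<phi> y \<le> \<delta> \<Longrightarrow> norm y \<le> \<epsilon>"
proof (rule ccontr)
  note obt = that
  assume "\<not> thesis"
  then have no: "\<exists>y. 0 \<le> y \<and> y \<le> u \<and> \<phi> y \<le> \<delta> \<and> \<epsilon> < norm y"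
    if "positive_functional \<phi>" "\<delta> > 0" for \<phi> \<delta>
    using obt[OF that] not_le by blast
  \<comment> \<open>The total over any range of indices is at most \<epsilon> / 4.\<close>
  define \<eta> where "\<eta> n = \<epsilon> / 4 * (1/2) ^ Suc n" for n
  \<comment> \<open>State of the recursion: a functional that accumulates the earlier norming
    functionals, an element of large norm nearly invisible to it, and a functional norming that
    element.\<close>
  define P where "P n p \<longleftrightarrow> (case p of (\<phi>, y, \<psi>) \<Rightarrow>
      positive_functional \<phi> \<and> 0 \<le> y \<and> y \<le> u \<and> \<phi> y \<le> \<eta> n \<and> \<epsilon> < norm y \<and>
      positive_functional \<psi> \<and> (\<forall>x. \<psi> x \<le> norm x) \<and> \<psi> y = norm y)"
    for n and p :: "('a \<Rightarrow> real) \<times> 'a \<times> ('a \<Rightarrow> real)"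
  have ex: "\<exists>y \<psi>. P n (\<phi>, y, \<psi>)" if pf: "positive_functional \<phi>" for n \<phi>
  proof -
    have "\<eta> n > 0"
      using \<open>\<epsilon> > 0\<close> by (simp add: \<eta>_def)
    then obtain y where "0 \<le> y" "y \<le> u" "\<phi> y \<le> \<eta> n" "\<epsilon> < norm y"
      using no[OF pf] by blast
    then show ?thesis
      using pf norming_positive_functional[of y] unfolding P_def by (simp, metis)
  qed
  have "\<exists>F. \<forall>n. P n (F n) \<and>
      (case F n of (\<phi>, y, \<psi>) \<Rightarrow> fst (F (Suc n)) = (\<lambda>x. \<phi> x + \<psi> x))"
  proof (rule dependent_nat_choice)
    have "positive_functional (\<lambda>x::'a. 0)"
      by (simp add: positive_functional_def)
    then show "\<exists>p. P 0 p"
      using ex by blast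
    fix p n
    assume "P n p"
    obtain \<phi> y \<psi> where p: "p = (\<phi>, y, \<psi>)"
      by (cases p)
    have "positive_functional (\<lambda>x. \<phi> x + \<psi> x)"
      using \<open>P n p\<close> by (auto simp: P_def p positive_functional_def bounded_linear_add)
    from ex[OF this] show "\<exists>p'. P (Suc n) p' \<and>
        (case p of (\<phi>, y, \<psi>) \<Rightarrow> fst p' = (\<lambda>x. \<phi> x + \<psi> x))"
      by (auto simp: p)
  qed
  then obtain F where F: "\<forall>n. P n (F n) \<and>
      (case F n of (\<phi>, y, \<psi>) \<Rightarrow> fst (F (Suc n)) = (\<lambda>x. \<phi> x + \<psi> x))" ..
  define \<phi> where "\<phi> n = fst (F n)" for n
  define y where "y n = fst (snd (F n))" for n
  define \<psi> where "\<psi> n = snd (snd (F n))" for n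
  have \<phi>: "positive_functional (\<phi> n)" "\<phi> n (y n) \<le> \<eta> n" "\<phi> (Suc n) = (\<lambda>x. \<phi> n x + \<psi> n x)"
    and y: "0 \<le> y n" "y n \<le> u" "\<epsilon> < norm (y n)"
    and \<psi>: "positive_functional (\<psi> n)" "\<And>x. \<psi> n x \<le> norm x" "\<psi> n (y n) = norm (y n)" for n
    using F[rule_format, of n] by (auto simp: P_def \<phi>_def y_def \<psi>_def split: prod.splits)
  have \<psi>_le_\<phi>: "\<psi> i x \<le> \<phi> n x" if "i < n" "0 \<le> x" for i n x
    using that
  proof (induction n)
    case (Suc n)
    then show ?case
      using \<phi>(1)[of n] \<psi>(1)[of n] \<phi>(3)[of n] less_antisym[of i n]
      by (fastforce simp: positive_functional_def intro: add_increasing add_increasing2)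
  qed simp
  define s where "s k m = inf u (\<Sum>i\<in>{k..<m}. y i)" for k m
  have "\<exists>w. (\<forall>m. s k m \<le> w) \<and> (\<forall>b. (\<forall>m. s k m \<le> b) \<longrightarrow> w \<le> b) \<and> (\<forall>e>0. \<exists>m. norm (w - s k m) < e)" for k
  proof -
    have mono: "s k m \<le> s k m'" if "m \<le> m'" for m m'
      unfolding s_def using that y(1) by (intro inf_mono sum_mono2) auto
    have dir: "\<exists>c\<in>range (s k). a \<le> c \<and> b \<le> c" if ab: "a \<in> range (s k)" "b \<in> range (s k)" for a b
    proof -
      obtain m m' where "a = s k m" "b = s k m'"
        using ab by blast
      then show ?thesis
        using mono[of m "max m m'"] mono[of m' "max m m'"] by auto
    qed
    have bdd: "d \<le> u" if "d \<in> range (s k)" for d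
      using that by (auto simp: s_def)
    show ?thesis
      using directed_Sup_exists[OF ocn _ dir bdd] by simp
  qed
  then obtain W where W: "\<And>k m. s k m \<le> W k" "\<And>k b. (\<And>m. s k m \<le> b) \<Longrightarrow> W k \<le> b"
    "\<And>k e. e > 0 \<Longrightarrow> \<exists>m. norm (W k - s k m) < e"
    by metis
  have W_Suc: "W (Suc k) \<le> W k" for k
  proof (rule W(2))
    fix m
    have "s (Suc k) m \<le> s k m"
      unfolding s_def using y(1) by (intro inf_mono sum_mono2) auto
    then show "s (Suc k) m \<le> W k"
      using W(1) order_trans by blast
  qed
  have "0 \<le> W k" for k
    using W(1)[of k 0] \<open>0 \<le> u\<close> by (simp add: s_def inf_absorb2)
  have "y k \<le> W k" for k
    using W(1)[of k "Suc k"] y(2)[of k] by (simp add: s_def inf_absorb2)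
  \<comment> \<open>The functional \<open>\<psi> k\<close> exceeds \<epsilon> on \<open>W k\<close>,
    which lies above \<open>y k\<close>. On \<open>W (Suc k)\<close> it is less than \<epsilon> / 2:
    a quarter from the sum of the later \<eta>, a quarter from approximating by a finite
    sum.\<close>
  have gap: "\<epsilon> / 2 \<le> norm (W k - W (Suc k))" for k
  proof -
    obtain m where m: "norm (W (Suc k) - s (Suc k) m) < \<epsilon> / 4"
      using W(3)[of "\<epsilon> / 4" "Suc k"] \<open>\<epsilon> > 0\<close> by auto
    note lin = positive_functional_linear[OF \<psi>(1)[of k]]
    have "\<psi> k (s (Suc k) m) \<le> \<psi> k (\<Sum>i\<in>{Suc k..<m}. y i)"
      by (intro positive_functional_mono \<psi>(1)) (simp add: s_def)
    also have "\<dots> = (\<Sum>i\<in>{Suc k..<m}. \<psi> k (y i))"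
      by (rule linear_sum[OF lin])
    also have "\<dots> \<le> (\<Sum>i\<in>{Suc k..<m}. \<eta> i)"
      using \<psi>_le_\<phi> \<phi>(2) y(1) by (intro sum_mono) (meson Suc_le_eq atLeastLessThan_iff order_trans)
    also have "\<dots> = \<epsilon> / 4 * (\<Sum>i\<in>{Suc k..<m}. (1/2) ^ Suc i)"
      by (simp add: \<eta>_def sum_distrib_left)
    also have "\<dots> \<le> \<epsilon> / 4 * 1"
      using \<open>\<epsilon> > 0\<close> by (intro mult_left_mono sum_half_powers_le) auto
    finally have "\<psi> k (s (Suc k) m) \<le> \<epsilon> / 4" by simp
    moreover have "\<psi> k (W (Suc k)) - \<psi> k (s (Suc k) m) < \<epsilon> / 4"
      using m \<psi>(2)[of k "W (Suc k) - s (Suc k) m"] by (simp add: linear_diff[OF lin])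
    moreover have "\<epsilon> < \<psi> k (W k)"
      using positive_functional_mono[OF \<psi>(1) \<open>y k \<le> W k\<close>, of k] \<psi>(3)[of k] y(3)[of k] by simp
    ultimately show ?thesis
      using \<psi>(2)[of k "W k - W (Suc k)"] by (simp add: linear_diff[OF lin])
  qed
  have W_dec: "W n \<le> W m" if "m \<le> n" for m n
    using lift_Suc_antimono_le[of W, OF W_Suc that] .
  \<comment> \<open>Negation makes the decreasing sequence upward directed. Its supremum
    \<open>w\<close> gives \<open>W k - W (Suc k) \<le> w + W k\<close>, and the right-hand side
    becomes small in norm.\<close>
  have dir: "\<exists>c\<in>range (\<lambda>k. - W k). a \<le> c \<and> b \<le> c"
    if ab: "a \<in> range (\<lambda>k. - W k)" "b \<in> range (\<lambda>k. - W k)" for a b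
  proof -
    obtain m n where "a = - W m" "b = - W n"
      using ab by blast
    then show ?thesis
      using W_dec[of m "max m n"] W_dec[of n "max m n"] by auto
  qed
  have bdd: "d \<le> 0" if "d \<in> range (\<lambda>k. - W k)" for d
    using that \<open>\<And>k. 0 \<le> W k\<close> by auto
  obtain w where w: "\<forall>k. - W k \<le> w" "\<forall>e>0. \<exists>k. norm (w + W k) < e"
    using directed_Sup_exists[OF ocn _ dir bdd] by auto
  then obtain k where k: "norm (w + W k) < \<epsilon> / 2"
    using \<open>\<epsilon> > 0\<close> half_gt_zero by blast
  have "norm (W k - W (Suc k)) \<le> norm (w + W k)"
    using add_right_mono[OF w(1)[rule_format, of "Suc k"], of "W k"] W_Suc[of k]
    by (intro norm_mono_nonneg) simp_all
  then show False
    using k gap[of k] by simp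
qed

section \<open>Order ideals\<close>

lemma order_ideal_embedding_linear: "order_ideal_embedding j \<Longrightarrow> linear j"
  by (simp add: order_ideal_embedding_def)

lemma order_ideal_embedding_le_iff:
  assumes "order_ideal_embedding j"
  shows "j x \<le> j y \<longleftrightarrow> x \<le> y"
  using assms unfolding order_ideal_embedding_def le_iff_sup inj_def by metis

lemma order_ideal_embedding_abs:
  assumes "order_ideal_embedding j"
  shows "j \<bar>x\<bar> = \<bar>j x\<bar>"
  using assms linear_neg[of j x] by (simp add: order_ideal_embedding_def abs_lattice)

lemma order_ideal_embedding_nonneg_iff:
  assumes "order_ideal_embedding j"
  shows "0 \<le> j x \<longleftrightarrow> 0 \<le> x"
  using order_ideal_embedding_le_iff[OF assms, of 0 x] linear_0[OF order_ideal_embedding_linear[OF assms]]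
  by simp

lemma order_ideal_embedding_range:
  assumes "order_ideal_embedding j" "0 \<le> y" "y \<le> j x"
  obtains z where "y = j z"
proof -
  have "\<bar>y\<bar> \<le> \<bar>j x\<bar>"
    using assms(2,3) by simp
  then have "y \<in> range j"
    using assms(1) unfolding order_ideal_embedding_def order_ideal_def by blast
  then show thesis
    using that by blast
qed

text \<open>The supremum is formed in the Banach lattice; lying between 0 and \<open>j v\<close>, it
  belongs to the ideal.\<close>

lemma order_ideal_directed_Sup_exists:
  fixes j :: "'f::vector_lattice \<Rightarrow> 'g::banach_lattice"
  assumes ocn: "order_continuous_norm TYPE('g)" and j: "order_ideal_embedding j"
    and "d0 \<in> D"
    and dir: "\<And>a b. a \<in> D \<Longrightarrow> b \<in> D \<Longrightarrow> \<exists>c\<in>D. a \<le> c \<and> b \<le> c"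
    and bdd: "\<And>d. d \<in> D \<Longrightarrow> 0 \<le> d \<and> d \<le> v"
  shows "\<exists>s. (\<forall>d\<in>D. d \<le> s) \<and> (\<forall>b. (\<forall>d\<in>D. d \<le> b) \<longrightarrow> s \<le> b) \<and>
    (\<forall>\<epsilon>>0. \<exists>d\<in>D. norm (j s - j d) < \<epsilon>)"
proof -
  note le_iff = order_ideal_embedding_le_iff[OF j]
  have jdir: "\<exists>c\<in>j ` D. a \<le> c \<and> b \<le> c" if ab: "a \<in> j ` D" "b \<in> j ` D" for a b
  proof -
    obtain a' b' where "a = j a'" "b = j b'" "a' \<in> D" "b' \<in> D"
      using ab by blast
    then show ?thesis
      using dir[of a' b'] le_iff by blast
  qed
  have jbdd: "d \<le> j v" if "d \<in> j ` D" for d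
    using that bdd le_iff by blast
  have "j ` D \<noteq> {}"
    using \<open>d0 \<in> D\<close> by blast
  from directed_Sup_exists[OF ocn this jdir jbdd] obtain t where
    t: "\<forall>d\<in>D. j d \<le> t" "\<forall>b. (\<forall>d\<in>D. j d \<le> b) \<longrightarrow> t \<le> b" "\<forall>\<epsilon>>0. \<exists>d\<in>D. norm (t - j d) < \<epsilon>"
    by auto
  have "0 \<le> j d0"
    using bdd[OF \<open>d0 \<in> D\<close>] order_ideal_embedding_nonneg_iff[OF j] by blast
  then have "0 \<le> t"
    using t(1) \<open>d0 \<in> D\<close> order_trans by blast
  moreover have "t \<le> j v"
    using t(2) bdd le_iff by blast
  ultimately obtain s where s: "t = j s"
    using order_ideal_embedding_range[OF j] by blast
  have "s \<le> b" if "\<forall>d\<in>D. d \<le> b" for b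
    using t(2)[rule_format, of "j b"] that by (simp add: s le_iff)
  with t show ?thesis
    unfolding s le_iff by blast
qed


section \<open>The modulus as a supremum over partitions\<close>

text \<open>\<open>partition_sum T x v\<close> means that \<open>v\<close> is the sum of the \<open>\<bar>T (x i)\<bar>\<close> for some decomposition
  of \<open>x\<close> into finitely many pairwise disjoint \<open>x i\<close>, obtained by successive splitting.\<close>

inductive partition_sum :: "('e::vector_lattice \<Rightarrow> 'f::vector_lattice) \<Rightarrow> 'e \<Rightarrow> 'f \<Rightarrow> bool"
  for T where
  single: "partition_sum T x \<bar>T x\<bar>"
| add: "partition_sum T x v \<Longrightarrow> partition_sum T y w \<Longrightarrow> lat_disjoint x y \<Longrightarrow>
    partition_sum T (x + y) (v + w)"

text \<open>Cutting every piece along \<open>y\<close> and \<open>z\<close> can only increase the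
  sum, by the triangle inequality.\<close>

lemma partition_sum_refine:
  assumes "orthogonally_additive T" "partition_sum T x v" "disjoint_sum x y z"
  shows "\<exists>v1 v2. partition_sum T y v1 \<and> partition_sum T z v2 \<and> v \<le> v1 + v2"
  using assms(2,3)
proof (induction arbitrary: y z)
  case (single x)
  have "\<bar>T x\<bar> \<le> \<bar>T y\<bar> + \<bar>T z\<bar>"
    using orthogonally_additiveD[OF assms(1) single] abs_triangle_ineq by simp
  then show ?case
    using partition_sum.single by blast
next
  case (add x1 w1 x2 w2)
  have yz: "lat_disjoint y z" "x1 + x2 = y + z"
    using add.prems by (simp_all add: disjoint_sum_def)
  obtain a b c d where s: "disjoint_sum x1 a b" "disjoint_sum x2 c d"
    "disjoint_sum y a c" "disjoint_sum z b d"
    using common_refinement[OF add.hyps(3) yz] by blast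
  obtain va vb vc vd where v: "partition_sum T a va" "partition_sum T b vb" "w1 \<le> va + vb"
    "partition_sum T c vc" "partition_sum T d vd" "w2 \<le> vc + vd"
    using add.IH(1)[OF s(1)] add.IH(2)[OF s(2)] by blast
  have "partition_sum T y (va + vc)" "partition_sum T z (vb + vd)"
    using s(3,4) v partition_sum.add unfolding disjoint_sum_def by blast+
  moreover have "w1 + w2 \<le> (va + vc) + (vb + vd)"
    using add_mono[OF v(3,6)] by (simp add: ac_simps)
  ultimately show ?case by blast
qed

lemma abs_le_partition_sum:
  assumes "orthogonally_additive T" "partition_sum T x v"
  shows "\<bar>T x\<bar> \<le> v"
  using assms(2)
proof induction
  case (add x v y w)
  then show ?case
    using assms(1) abs_triangle_ineq[of "T x" "T y"] add_mono[OF add.IH]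
    by (simp add: orthogonally_additive_def)
qed simp

lemma partition_sum_directed:
  assumes "orthogonally_additive T" "partition_sum T x v" "partition_sum T x w"
  shows "\<exists>u. partition_sum T x u \<and> v \<le> u \<and> w \<le> u"
  using assms(2,3)
proof (induction arbitrary: w)
  case (single x)
  then show ?case
    using abs_le_partition_sum[OF assms(1)] by blast
next
  case (add x1 v1 x2 v2)
  have "disjoint_sum (x1 + x2) x1 x2"
    using add.hyps by (simp add: disjoint_sum_def)
  from partition_sum_refine[OF assms(1) add.prems this] obtain w1 w2
    where w: "partition_sum T x1 w1" "partition_sum T x2 w2" "w \<le> w1 + w2"
    by blast
  obtain u1 u2 where "partition_sum T x1 u1" "v1 \<le> u1" "w1 \<le> u1"
    "partition_sum T x2 u2" "v2 \<le> u2" "w2 \<le> u2"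
    using add.IH(1)[OF w(1)] add.IH(2)[OF w(2)] by blast
  then show ?case
    using add.hyps(3) w(3) by (meson add_mono order_trans partition_sum.add)
qed

text \<open>A sum of moduli is the supremum of the signed sums, and a signed sum is some
  \<open>T y - T z\<close> with \<open>y\<close> collecting the pieces of positive sign. The bound
  stays arbitrary in the induction so that the contribution of one summand can be moved to its
  side.\<close>

lemma partition_sum_le:
  assumes "orthogonally_additive T" "partition_sum T x v"
    and "\<And>y z. disjoint_sum x y z \<Longrightarrow> T y - T z \<le> b"
  shows "v \<le> b"
  using assms(2,3)
proof (induction arbitrary: b)
  case (single x)
  have "T x - T 0 \<le> b" "T 0 - T x \<le> b"
    using single disjoint_sum_sym[OF disjoint_sum_0] by auto
  then show ?case
    by (intro abs_leI) (simp_all add: orthogonally_additive_0[OF assms(1)])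
next
  case (add x v y w)
  have "w \<le> b - v"
  proof (rule add.IH(2))
    fix y1 y2
    assume y: "disjoint_sum y y1 y2"
    have "v \<le> b - (T y1 - T y2)"
    proof (rule add.IH(1))
      fix x1 x2
      assume x: "disjoint_sum x x1 x2"
      have "T (x1 + y1) - T (x2 + y2) \<le> b"
        by (rule add.prems[OF disjoint_sum_add[OF x y add.hyps(3)]])
      moreover have "T (x1 + y1) = T x1 + T y1" "T (x2 + y2) = T x2 + T y2"
        using assms(1) disjoint_sum_disjoint[OF x y add.hyps(3)]
        by (simp_all add: orthogonally_additive_def)
      ultimately show "T x1 - T x2 \<le> b - (T y1 - T y2)"
        by (simp add: algebra_simps)
    qed
    then show "T y1 - T y2 \<le> b - v"
      by (simp add: algebra_simps)
  qed
  then show ?case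
    by (simp add: algebra_simps)
qed

lemma partition_sum_le_majorant:
  assumes "orthogonally_additive S" "\<And>x. \<bar>T x\<bar> \<le> S x" "partition_sum T x v"
  shows "v \<le> S x"
  using assms(3)
proof induction
  case (add x v y w)
  then show ?case
    using assms(1) by (simp add: orthogonally_additive_def add_mono)
qed (rule assms(2))

lemma uryson_bounded:
  assumes "T \<in> uryson_operators"
  obtains b where "\<And>x y. \<bar>x\<bar> \<le> c \<Longrightarrow> \<bar>y\<bar> \<le> c \<Longrightarrow> T x - T y \<le> b"
proof -
  have "order_bounded (T ` {-c..c})"
    using assms unfolding uryson_operators_def order_bounded_def by blast
  then obtain p q where pq: "T ` {-c..c} \<subseteq> {p..q}"
    unfolding order_bounded_def by blast
  have "T x - T y \<le> q - p" if "\<bar>x\<bar> \<le> c" "\<bar>y\<bar> \<le> c" for x y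
  proof -
    have "x \<in> {-c..c}" "y \<in> {-c..c}"
      using that by (auto simp: abs_le_iff minus_le_iff)
    then have "T x \<in> {p..q}" "T y \<in> {p..q}"
      using pq by blast+
    then show ?thesis
      by (intro diff_mono) auto
  qed
  then show thesis
    using that by blast
qed

text \<open>Sums over partitions replace the differences \<open>T y - T z\<close> because they are
  directed upwards, which the differences in general are not. Directedness yields the supremum and
  its approximation in norm at once.\<close>

lemma uryson_modulus_exists:
  fixes T :: "'e::vector_lattice \<Rightarrow> 'f::vector_lattice" and j :: "'f \<Rightarrow> 'g::banach_lattice"
  assumes ocn: "order_continuous_norm TYPE('g)" and j: "order_ideal_embedding j"
    and T: "T \<in> uryson_operators"
  obtains M where "is_uryson_modulus T M"
    "\<And>x v. partition_sum T x v \<Longrightarrow> v \<le> M x"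
    "\<And>x \<epsilon>. \<epsilon> > 0 \<Longrightarrow> \<exists>v. partition_sum T x v \<and> norm (j (M x) - j v) < \<epsilon>"
proof -
  have add: "orthogonally_additive T"
    using T by (simp add: uryson_operators_def)
  have nonneg: "0 \<le> v" if "partition_sum T x v" for x v
    using abs_le_partition_sum[OF add that] abs_ge_zero order_trans by blast
  have bdd: "\<exists>b. \<forall>x v. \<bar>x\<bar> \<le> c \<longrightarrow> partition_sum T x v \<longrightarrow> v \<le> b" for c
  proof -
    obtain b where b: "\<And>x y. \<bar>x\<bar> \<le> c \<Longrightarrow> \<bar>y\<bar> \<le> c \<Longrightarrow> T x - T y \<le> b"
      using uryson_bounded[OF T] by blast
    have "v \<le> b" if x: "\<bar>x\<bar> \<le> c" "partition_sum T x v" for x v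
    proof (rule partition_sum_le[OF add x(2)])
      show "T y - T z \<le> b" if "disjoint_sum x y z" for y z
        using disjoint_sum_abs_le[OF that] x(1) by (intro b) (auto elim: order_trans)
    qed
    then show ?thesis by blast
  qed
  have "\<exists>s. (\<forall>d\<in>{v. partition_sum T x v}. d \<le> s) \<and>
      (\<forall>b. (\<forall>d\<in>{v. partition_sum T x v}. d \<le> b) \<longrightarrow> s \<le> b) \<and>
      (\<forall>\<epsilon>>0. \<exists>d\<in>{v. partition_sum T x v}. norm (j s - j d) < \<epsilon>)" for x
  proof -
    obtain b where b: "\<And>v. partition_sum T x v \<Longrightarrow> v \<le> b"
      using bdd[of "\<bar>x\<bar>"] by blast
    show ?thesis
    proof (rule order_ideal_directed_Sup_exists[OF ocn j])
      show "\<bar>T x\<bar> \<in> {v. partition_sum T x v}"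
        by (simp add: partition_sum.single)
      show "\<exists>c\<in>{v. partition_sum T x v}. v \<le> c \<and> w \<le> c"
        if "v \<in> {v. partition_sum T x v}" "w \<in> {v. partition_sum T x v}" for v w
        using partition_sum_directed[OF add, of x v w] that by auto
      show "0 \<le> v \<and> v \<le> b" if "v \<in> {v. partition_sum T x v}" for v
        using that b nonneg by simp
    qed
  qed
  then obtain M where upper: "\<And>x v. partition_sum T x v \<Longrightarrow> v \<le> M x"
    and least: "\<And>x b. (\<And>v. partition_sum T x v \<Longrightarrow> v \<le> b) \<Longrightarrow> M x \<le> b"
    and approx: "\<And>x \<epsilon>. \<epsilon> > 0 \<Longrightarrow> \<exists>v. partition_sum T x v \<and> norm (j (M x) - j v) < \<epsilon>"
    by (simp, metis)
  have abs_le: "\<bar>T x\<bar> \<le> M x" for x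
    by (intro upper partition_sum.single)
  have M_add: "orthogonally_additive M"
    unfolding orthogonally_additive_def
  proof (intro allI impI order.antisym)
    fix x y :: 'e
    assume xy: "lat_disjoint x y"
    then have d: "disjoint_sum (x + y) x y"
      by (simp add: disjoint_sum_def)
    show "M (x + y) \<le> M x + M y"
    proof (rule least)
      fix v
      assume "partition_sum T (x + y) v"
      from partition_sum_refine[OF add this d] show "v \<le> M x + M y"
        using upper by (meson add_mono order_trans)
    qed
    have "M y \<le> M (x + y) - M x"
    proof (rule least)
      fix w
      assume w: "partition_sum T y w"
      have "M x \<le> M (x + y) - w"
        using upper[OF partition_sum.add[OF _ w xy]] by (intro least) (simp add: le_diff_eq)
      then show "w \<le> M (x + y) - M x"
        by (simp add: algebra_simps)
    qed
    then show "M x + M y \<le> M (x + y)"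
      by (simp add: algebra_simps)
  qed
  have "order_bounded (M ` A)" if A: "order_bounded A" for A
  proof -
    obtain a b where ab: "A \<subseteq> {a..b}"
      using A unfolding order_bounded_def by blast
    have "\<bar>x\<bar> \<le> \<bar>a\<bar> + \<bar>b\<bar>" if "x \<in> A" for x
    proof (rule abs_leI)
      have "a \<le> x" "x \<le> b"
        using ab that by auto
      have "x \<le> \<bar>b\<bar>"
        using \<open>x \<le> b\<close> abs_ge_self order_trans by blast
      then show "x \<le> \<bar>a\<bar> + \<bar>b\<bar>"
        by (simp add: add_increasing)
      have "- x \<le> \<bar>a\<bar>"
        using \<open>a \<le> x\<close> abs_ge_minus_self[of a] by (meson neg_le_iff_le order_trans)
      then show "- x \<le> \<bar>a\<bar> + \<bar>b\<bar>"
        by (simp add: add_increasing2)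
    qed
    moreover obtain c where "\<forall>x v. \<bar>x\<bar> \<le> \<bar>a\<bar> + \<bar>b\<bar> \<longrightarrow> partition_sum T x v \<longrightarrow> v \<le> c"
      using bdd by blast
    ultimately have "M x \<le> c" if "x \<in> A" for x
      using that by (intro least) blast
    moreover have "0 \<le> M x" for x
      using abs_le abs_ge_zero order_trans by blast
    ultimately show ?thesis
      unfolding order_bounded_def by (intro exI[of _ 0] exI[of _ c]) auto
  qed
  then have "M \<in> uryson_operators"
    using M_add by (simp add: uryson_operators_def)
  moreover have "uryson_le M S"
    if S: "S \<in> uryson_operators" "uryson_le T S" "uryson_le (\<lambda>x. - T x) S" for S
  proof -
    have major: "orthogonally_additive S" "\<And>x. \<bar>T x\<bar> \<le> S x"
      using S unfolding uryson_operators_def uryson_le_def diff_ge_0_iff_ge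
      by (auto intro: abs_leI)
    have "M x \<le> S x" for x
      by (rule least) (rule partition_sum_le_majorant[OF major])
    then show ?thesis
      by (simp add: uryson_le_def)
  qed
  moreover have "uryson_le T M" "uryson_le (\<lambda>x. - T x) M"
    using abs_le unfolding uryson_le_def diff_ge_0_iff_ge by (simp_all add: abs_le_iff)
  ultimately have "is_uryson_modulus T M"
    by (simp add: is_uryson_modulus_def)
  then show thesis
    using that upper approx by blast
qed


section \<open>Order narrow and norm narrow operators\<close>

definition norm_narrow :: "('e::vector_lattice \<Rightarrow> 'g::banach_lattice) \<Rightarrow> bool" where
  "norm_narrow T \<longleftrightarrow> (\<forall>e. \<forall>\<epsilon>>0. \<exists>f g. disjoint_sum e f g \<and> norm (T f - T g) < \<epsilon>)"

lemma order_narrow_imp_norm_narrow: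
  fixes j :: "'f::vector_lattice \<Rightarrow> 'g::banach_lattice"
  assumes ocn: "order_continuous_norm TYPE('g)" and j: "order_ideal_embedding j"
    and "order_narrow T"
  shows "norm_narrow (\<lambda>x. j (T x))"
  unfolding norm_narrow_def
proof (intro allI impI)
  fix e and \<epsilon> :: real
  assume "\<epsilon> > 0"
  obtain A :: "'f set" and r f g u where *: "directed_set A r" "\<forall>a\<in>A. disjoint_sum e (f a) (g a)"
    "decreases_to_0 A r u" "\<forall>a\<in>A. \<bar>T (f a) - T (g a) - 0\<bar> \<le> u a"
    using assms(3) unfolding order_narrow_def order_converges_def by blast
  note le_iff = order_ideal_embedding_le_iff[OF j]
  \<comment> \<open>The infimum is tested in the larger lattice, where a lower bound
    \<open>w\<close> need not come from the ideal; its positive part does, being squeezed between 0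
    and \<open>j (u a)\<close>.\<close>
  have "w \<le> 0" if w: "\<forall>a\<in>A. w \<le> j (u a)" for w
  proof -
    have u: "0 \<le> j (u a)" if "a \<in> A" for a
      using *(3) that by (simp add: decreases_to_0_def order_ideal_embedding_nonneg_iff[OF j])
    then have p: "pprt w \<le> j (u a)" if "a \<in> A" for a
      using w that by (simp add: pprt_def)
    obtain a where "a \<in> A"
      using *(1) by (auto simp: directed_set_def)
    then obtain z where z: "pprt w = j z"
      using order_ideal_embedding_range[OF j zero_le_pprt p] by blast
    then have "z \<le> 0"
      using p *(3) by (simp add: decreases_to_0_def le_iff)
    then have "pprt w \<le> 0"
      using le_iff[of z 0] z linear_0[OF order_ideal_embedding_linear[OF j]] by simp
    then show ?thesis
      by (simp add: pprt_def)
  qed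
  then have "decreases_to_0 A r (\<lambda>a. j (u a))"
    using *(3) by (simp add: decreases_to_0_def le_iff order_ideal_embedding_nonneg_iff[OF j])
  from order_continuous_normD[OF ocn *(1) this \<open>\<epsilon> > 0\<close>] obtain a
    where a: "a \<in> A" "norm (j (u a)) < \<epsilon>"
    using *(1) unfolding directed_set_def by blast
  have "\<bar>j (T (f a)) - j (T (g a))\<bar> \<le> j (u a)"
    using *(4) a(1) by (simp add: le_iff flip: order_ideal_embedding_abs[OF j]
        linear_diff[OF order_ideal_embedding_linear[OF j]])
  then have "norm (j (T (f a)) - j (T (g a))) \<le> norm (j (u a))"
    by (intro norm_mono_abs) (meson abs_ge_self order_trans)
  then show "\<exists>f g. disjoint_sum e f g \<and> norm (j (T f) - j (T g)) < \<epsilon>"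
    using *(2) a by fastforce
qed

text \<open>Choosing splittings with \<open>norm (j (T (f n) - T (g n))) < (1/2) ^ n\<close>, the tails of the series
  of moduli, truncated at an order bound, decrease to \<open>0\<close>.\<close>

lemma norm_narrow_imp_order_narrow:
  fixes j :: "'f::vector_lattice \<Rightarrow> 'g::banach_lattice"
  assumes j: "order_ideal_embedding j" and T: "T \<in> uryson_operators"
    and "norm_narrow (\<lambda>x. j (T x))"
  shows "order_narrow T"
proof (rule order_narrowI)
  fix e
  note le_iff = order_ideal_embedding_le_iff[OF j]
  note lin = order_ideal_embedding_linear[OF j]
  have "\<exists>f g. disjoint_sum e f g \<and> norm (j (T f) - j (T g)) < (1/2) ^ n" for n
    using assms(3) by (simp add: norm_narrow_def)
  then obtain f g where fg: "\<And>n. disjoint_sum e (f n) (g n)"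
    and small: "\<And>n. norm (j (T (f n)) - j (T (g n))) < (1/2) ^ n"
    by metis
  define y where "y n = j \<bar>T (f n) - T (g n)\<bar>" for n
  have y_small: "norm (y n) < (1/2) ^ n" for n
    using small[of n] by (simp add: y_def order_ideal_embedding_abs[OF j] linear_diff[OF lin])
  have y_nonneg: "0 \<le> y n" for n
    by (simp add: y_def order_ideal_embedding_nonneg_iff[OF j])
  obtain b where b: "\<And>x y. \<bar>x\<bar> \<le> \<bar>e\<bar> \<Longrightarrow> \<bar>y\<bar> \<le> \<bar>e\<bar> \<Longrightarrow> T x - T y \<le> b"
    using uryson_bounded[OF T] by blast
  have "T (f n) - T (g n) \<le> b" "T (g n) - T (f n) \<le> b" for n
    using disjoint_sum_abs_le[OF fg[of n]] b by auto
  then have y_le: "y n \<le> j b" for n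
    unfolding y_def le_iff by (intro abs_leI) auto
  have geom: "summable (\<lambda>i. (1/2::real) ^ (i + n))" "(\<Sum>i. (1/2::real) ^ (i + n)) = 2 * (1/2) ^ n" for n
  proof -
    have "(\<lambda>i. (1/2) ^ n * (1/2::real) ^ i) sums ((1/2) ^ n * 2)"
      using geometric_sums[of "1/2::real"] by (intro sums_mult) simp
    then show "summable (\<lambda>i. (1/2::real) ^ (i + n))" "(\<Sum>i. (1/2::real) ^ (i + n)) = 2 * (1/2) ^ n"
      by (auto simp: sums_iff power_add mult.commute)
  qed
  have summable: "summable (\<lambda>i. norm (y (i + n)))" for n
    using y_small by (intro summable_comparison_test'[OF geom(1)[of n], of 0]) (simp add: less_imp_le)
  define t where "t n = (\<Sum>i. y (i + n))" for n
  have t_small: "norm (t n) \<le> 2 * (1/2) ^ n" for n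
  proof -
    have "norm (t n) \<le> (\<Sum>i. norm (y (i + n)))"
      unfolding t_def by (rule summable_norm[OF summable])
    also have "\<dots> \<le> (\<Sum>i. (1/2) ^ (i + n))"
      using y_small by (intro suminf_le summable geom) (simp add: less_imp_le)
    finally show ?thesis
      by (simp add: geom)
  qed
  have t_Suc: "t n = y n + t (Suc n)" for n
    unfolding t_def using suminf_split_head[OF summable_norm_cancel[OF summable[of n]]] by simp
  have t_pos: "0 \<le> t n" for n
  proof -
    have "- t n \<le> 0"
    proof (rule le_0_if_le_small)
      fix \<epsilon> :: real
      assume "\<epsilon> > 0"
      then obtain k where k: "(1/2::real) ^ k < \<epsilon> / 2"
        using real_arch_pow_inv[of "\<epsilon> / 2" "1/2"] by auto
      have "(1/2::real) ^ (k + n) \<le> (1/2) ^ k"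
        by (intro power_decreasing) auto
      then have "norm (t (k + n)) < \<epsilon>"
        using t_small[of "k + n"] k by linarith
      moreover have "t (k + n) \<le> t n"
      proof (induction k)
        case (Suc k)
        then show ?case
          using t_Suc[of "k + n"] y_nonneg[of "k + n"] by (metis add_Suc add_increasing order_refl order_trans)
      qed simp
      ultimately show "\<exists>w. - t n \<le> w \<and> norm w < \<epsilon>"
        by (intro exI[of _ "- t (k + n)"]) simp
    qed
    then show ?thesis by simp
  qed
  \<comment> \<open>The series converges only in the Banach lattice; truncating its tails at
    \<open>j b\<close> brings them back into the ideal.\<close>
  have "\<exists>u. j u = inf (t n) (j b)" for n
  proof -
    have "0 \<le> inf (t n) (j b)"
      using t_pos[of n] y_nonneg[of n] y_le[of n] by (auto intro: order_trans)
    then show ?thesis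
      using order_ideal_embedding_range[OF j, of "inf (t n) (j b)" b] by (metis inf_le2)
  qed
  then obtain u where u: "\<And>n. j (u n) = inf (t n) (j b)"
    by metis
  have "decreases_to_0 UNIV (\<le>) u"
    unfolding decreases_to_0_def
  proof (intro conjI ballI allI impI)
    have "u (Suc n) \<le> u n" for n
      unfolding le_iff[symmetric] u using t_Suc[of n] y_nonneg[of n]
      by (intro inf_mono) simp_all
    then show "u n \<le> u m" if "m \<le> n" for m n
      using lift_Suc_antimono_le[of u m n] that by blast
    show "0 \<le> u n" for n
      unfolding order_ideal_embedding_nonneg_iff[OF j, symmetric] u
      using t_pos[of n] y_nonneg[of n] y_le[of n] by (auto intro: order_trans)
  next
    fix w
    assume w: "\<forall>n\<in>UNIV. w \<le> u n"
    have "j w \<le> 0"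
    proof (rule le_0_if_le_small)
      fix \<epsilon> :: real
      assume "\<epsilon> > 0"
      then obtain n where "(1/2::real) ^ n < \<epsilon> / 2"
        using real_arch_pow_inv[of "\<epsilon> / 2" "1/2"] by auto
      moreover have "j w \<le> j (u n)"
        using w by (simp add: le_iff)
      then have "j w \<le> t n"
        by (simp add: u)
      ultimately show "\<exists>v. j w \<le> v \<and> norm v < \<epsilon>"
        using t_small[of n] by (intro exI[of _ "t n"]) simp
    qed
    then show "w \<le> 0"
      using le_iff[of w 0] linear_0[OF lin] by simp
  qed
  moreover have "\<bar>T (f n) - T (g n) - 0\<bar> \<le> u n" for n
  proof -
    have "y n \<le> inf (t n) (j b)"
      using t_Suc[of n] t_pos[of "Suc n"] y_le[of n] by simp
    then show ?thesis
      by (simp add: y_def le_iff flip: u)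
  qed
  ultimately show "\<exists>(A::nat set) r f g. directed_set A r \<and> (\<forall>a\<in>A. disjoint_sum e (f a) (g a)) \<and>
      order_converges A r (\<lambda>a. T (f a) - T (g a)) 0"
    using fg unfolding order_converges_def
    by (intro exI[of _ UNIV] exI[of _ "(\<le>)"] exI[of _ f] exI[of _ g])
      (auto simp: directed_set_def intro: max.cobounded1 max.cobounded2)
qed

section \<open>From the operator to its modulus\<close>

text \<open>Nearly equal values of \<open>T\<close> have nearly equal moduli, so each piece is split
  separately. The tolerance is arbitrary in the induction because every joining of two partitions
  halves it.\<close>

lemma partition_sum_balanced:
  fixes j :: "'f::vector_lattice \<Rightarrow> 'g::banach_lattice"
  assumes j: "order_ideal_embedding j" and T: "orthogonally_additive T"
    and narrow: "norm_narrow (\<lambda>x. j (T x))"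
    and "partition_sum T e v" "\<epsilon> > 0"
  shows "\<exists>f g vf vg. disjoint_sum e f g \<and> partition_sum T f vf \<and> partition_sum T g vg \<and>
    v \<le> vf + vg \<and> norm (j vf - j vg) < \<epsilon>"
  using assms(4,5)
proof (induction arbitrary: \<epsilon>)
  case (single e)
  then obtain f g where fg: "disjoint_sum e f g" "norm (j (T f) - j (T g)) < \<epsilon>"
    using narrow unfolding norm_narrow_def by blast
  have "norm (j \<bar>T f\<bar> - j \<bar>T g\<bar>) \<le> norm (j (T f) - j (T g))"
    unfolding order_ideal_embedding_abs[OF j] by (intro norm_mono_abs abs_triangle_ineq3)
  moreover have "\<bar>T e\<bar> \<le> \<bar>T f\<bar> + \<bar>T g\<bar>"
    using orthogonally_additiveD[OF T fg(1)] abs_triangle_ineq by simp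
  ultimately show ?case
    using fg partition_sum.single by (meson order_le_less_trans)
next
  case (add x v y w)
  obtain f g vf vg where x: "disjoint_sum x f g" "partition_sum T f vf" "partition_sum T g vg"
    "v \<le> vf + vg" "norm (j vf - j vg) < \<epsilon> / 2"
    using add.IH(1)[of "\<epsilon> / 2"] add.prems by auto
  obtain f' g' vf' vg' where y: "disjoint_sum y f' g'" "partition_sum T f' vf'" "partition_sum T g' vg'"
    "w \<le> vf' + vg'" "norm (j vf' - j vg') < \<epsilon> / 2"
    using add.IH(2)[of "\<epsilon> / 2"] add.prems by auto
  note dis = disjoint_sum_disjoint[OF x(1) y(1) add.hyps(3)]
  show ?case
  proof (intro exI conjI)
    show "disjoint_sum (x + y) (f + f') (g + g')"
      by (rule disjoint_sum_add[OF x(1) y(1) add.hyps(3)])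
    show "partition_sum T (f + f') (vf + vf')" "partition_sum T (g + g') (vg + vg')"
      using x y dis by (auto intro: partition_sum.add)
    show "v + w \<le> (vf + vf') + (vg + vg')"
      using add_mono[OF x(4) y(4)] by (simp add: ac_simps)
    have "j (vf + vf') - j (vg + vg') = (j vf - j vg) + (j vf' - j vg')"
      by (simp add: linear_add[OF order_ideal_embedding_linear[OF j]])
    then show "norm (j (vf + vf') - j (vg + vg')) < \<epsilon>"
      using norm_triangle_ineq[of "j vf - j vg" "j vf' - j vg'"] x(5) y(5) by simp
  qed
qed

text \<open>As \<open>v \<le> vf + vg \<le> M f + M g = M e\<close>, if \<open>v\<close> is close to \<open>M e\<close>, then \<open>M f\<close> and \<open>M g\<close> are close to \<open>vf\<close>
  and \<open>vg\<close>.\<close>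

lemma norm_narrow_modulus:
  fixes j :: "'f::vector_lattice \<Rightarrow> 'g::banach_lattice"
  assumes j: "order_ideal_embedding j" and T: "orthogonally_additive T"
    and M: "orthogonally_additive M"
    and upper: "\<And>x v. partition_sum T x v \<Longrightarrow> v \<le> M x"
    and approx: "\<And>x \<epsilon>. \<epsilon> > 0 \<Longrightarrow> \<exists>v. partition_sum T x v \<and> norm (j (M x) - j v) < \<epsilon>"
    and narrow: "norm_narrow (\<lambda>x. j (T x))"
  shows "norm_narrow (\<lambda>x. j (M x))"
  unfolding norm_narrow_def
proof (intro allI impI)
  fix e and \<epsilon> :: real
  assume "\<epsilon> > 0"
  then have "\<epsilon> / 3 > 0" by simp
  note lin = order_ideal_embedding_linear[OF j]
  obtain v where v: "partition_sum T e v" "norm (j (M e) - j v) < \<epsilon> / 3"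
    using approx[OF \<open>\<epsilon> / 3 > 0\<close>] by blast
  obtain f g vf vg where fg: "disjoint_sum e f g" "partition_sum T f vf" "partition_sum T g vg"
    "v \<le> vf + vg" "norm (j vf - j vg) < \<epsilon> / 3"
    using partition_sum_balanced[OF j T narrow v(1) \<open>\<epsilon> / 3 > 0\<close>] by blast
  have M_le: "vf \<le> M f" "vg \<le> M g"
    using upper fg by auto
  have "M f - vf \<le> M e - v" "M g - vg \<le> M e - v"
    using add_mono[OF M_le(2) fg(4)] add_mono[OF M_le(1) fg(4)] orthogonally_additiveD[OF M fg(1)]
    by (simp_all add: algebra_simps)
  then have "norm (j (M f) - j vf) \<le> norm (j (M e) - j v)" "norm (j (M g) - j vg) \<le> norm (j (M e) - j v)"
    using M_le unfolding linear_diff[OF lin, symmetric]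
    by (auto intro!: norm_mono_nonneg
        simp: order_ideal_embedding_nonneg_iff[OF j] order_ideal_embedding_le_iff[OF j])
  moreover have "norm (j (M f) - j (M g)) \<le>
      norm (j (M f) - j vf) + norm (j vf - j vg) + norm (j (M g) - j vg)"
  proof -
    have "norm (j (M f) - j (M g)) =
        norm (((j (M f) - j vf) + (j vf - j vg)) - (j (M g) - j vg))"
      by simp
    also have "\<dots> \<le> norm ((j (M f) - j vf) + (j vf - j vg)) + norm (j (M g) - j vg)"
      by (rule norm_triangle_ineq4)
    also have "\<dots> \<le> norm (j (M f) - j vf) + norm (j vf - j vg) + norm (j (M g) - j vg)"
      by (intro add_right_mono norm_triangle_ineq)
    finally show ?thesis .
  qed
  ultimately have "norm (j (M f) - j (M g)) < \<epsilon>"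
    using v(2) fg(5) by linarith
  then show "\<exists>f g. disjoint_sum e f g \<and> norm (j (M f) - j (M g)) < \<epsilon>"
    using fg(1) by blast
qed


section \<open>From the modulus to the operator\<close>

definition split_diffs :: "('e::vector_lattice \<Rightarrow> 'g::vector_lattice) \<Rightarrow> 'e \<Rightarrow> 'g set" where
  "split_diffs T e = {T f - T g | f g. disjoint_sum e f g}"

lemma split_diffs_add:
  assumes T: "orthogonally_additive T" and e: "disjoint_sum e e1 e2"
    and "z1 \<in> split_diffs T e1" "z2 \<in> split_diffs T e2"
  shows "z1 + z2 \<in> split_diffs T e" "z1 - z2 \<in> split_diffs T e"
proof -
  have sum: "z1 + z2 \<in> split_diffs T e"
    if z: "z1 \<in> split_diffs T e1" "z2 \<in> split_diffs T e2" for z1 z2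
  proof -
    obtain f1 g1 f2 g2 where d: "disjoint_sum e1 f1 g1" "disjoint_sum e2 f2 g2"
      and eq: "z1 = T f1 - T g1" "z2 = T f2 - T g2"
      using z unfolding split_diffs_def by blast
    have e': "lat_disjoint e1 e2" "e = e1 + e2"
      using e by (simp_all add: disjoint_sum_def)
    have "T (f1 + f2) = T f1 + T f2" "T (g1 + g2) = T g1 + T g2"
      using T disjoint_sum_disjoint[OF d e'(1)] by (simp_all add: orthogonally_additive_def)
    then have "z1 + z2 = T (f1 + f2) - T (g1 + g2)"
      by (simp add: eq)
    then show ?thesis
      unfolding split_diffs_def using disjoint_sum_add[OF d e'(1)] e'(2) by blast
  qed
  have "- z2 \<in> split_diffs T e2"
    using assms(4) disjoint_sum_sym unfolding split_diffs_def by force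
  then show "z1 + z2 \<in> split_diffs T e" "z1 - z2 \<in> split_diffs T e"
    using sum[OF assms(3,4)] sum[OF assms(3), of "- z2"] by simp_all
qed

lemma abs_split_diffs_le:
  assumes "orthogonally_additive S" "\<And>x. \<bar>T x\<bar> \<le> S x" "z \<in> split_diffs T e"
  shows "\<bar>z\<bar> \<le> S e"
proof -
  obtain f g where fg: "disjoint_sum e f g" "z = T f - T g"
    using assms(3) unfolding split_diffs_def by blast
  have "\<bar>z\<bar> \<le> \<bar>T f\<bar> + \<bar>T g\<bar>"
    unfolding fg(2) by (rule abs_triangle_ineq4)
  also have "\<dots> \<le> S f + S g"
    by (intro add_mono assms(2))
  also have "\<dots> = S e"
    by (rule orthogonally_additiveD[OF assms(1) fg(1), symmetric])
  finally show ?thesis .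
qed

text \<open>Halve \<open>e\<close> with respect to \<open>S\<close> and combine nearly optimal elements \<open>z1\<close>, \<open>z2\<close> of the two halves.
  One of \<open>z1 + z2\<close>, \<open>z1 - z2\<close> saves \<open>\<phi> (inf \<bar>z1\<bar> \<bar>z2\<bar>)\<close>. If this is less than \<open>\<eta>\<close>, then \<open>\<bar>z1\<bar> + \<bar>z2\<bar>\<close>
  is close to \<open>sup \<bar>z1\<bar> \<bar>z2\<bar>\<close>, so that the size relative to \<open>S e\<close> is halved.\<close>

lemma halving_step:
  fixes S T :: "'e::vector_lattice \<Rightarrow> 'g::banach_lattice"
  assumes S: "orthogonally_additive S" and T: "orthogonally_additive T"
    and T_le: "\<And>x. \<bar>T x\<bar> \<le> S x"
    and narrow: "norm_narrow S"
    and \<phi>: "positive_functional \<phi>"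
    and k: "\<And>e \<epsilon>. \<epsilon> > 0 \<Longrightarrow> \<exists>z\<in>split_diffs T e. \<phi> \<bar>z\<bar> \<le> k * \<phi> (S e) + \<epsilon>"
    and "\<eta> \<ge> 0" "\<epsilon> > 0"
  shows "\<exists>z\<in>split_diffs T e. \<phi> \<bar>z\<bar> \<le> k * \<phi> (S e) - \<eta> + \<epsilon> \<or>
    \<phi> \<bar>z\<bar> \<le> k * \<phi> (S e) + \<epsilon> \<and>
    (\<exists>r\<ge>0. \<bar>z\<bar> \<le> (1/2) ^ n *\<^sub>R S e + r \<and> \<phi> r \<le> (2 ^ n - 1) * \<eta> + \<epsilon>)"
  using \<open>\<epsilon> > 0\<close>
proof (induction n arbitrary: e \<epsilon>)
  case 0
  obtain z where z: "z \<in> split_diffs T e" "\<phi> \<bar>z\<bar> \<le> k * \<phi> (S e) + \<epsilon>"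
    using k 0 by blast
  moreover have "\<bar>z\<bar> \<le> (1/2) ^ 0 *\<^sub>R S e + 0"
    using abs_split_diffs_le[OF S T_le z(1)] by simp
  moreover have "\<phi> 0 \<le> (2 ^ 0 - 1) * \<eta> + \<epsilon>"
    using linear_0[OF positive_functional_linear[OF \<phi>]] 0 by simp
  ultimately show ?case by blast
next
  case (Suc n)
  note lin = positive_functional_linear[OF \<phi>]
  note add = linear_add[OF lin] and mono = positive_functional_mono[OF \<phi>]
  obtain K where K: "K > 0" "\<And>x. \<bar>\<phi> x\<bar> \<le> norm x * K"
    using \<phi> bounded_linear.pos_bounded[of \<phi>] unfolding positive_functional_def by auto
  have "\<epsilon> / (4 * K) > 0"
    using Suc.prems K(1) by simp
  then obtain e1 e2 where e: "disjoint_sum e e1 e2" and S_small: "norm (S e1 - S e2) < \<epsilon> / (4 * K)"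
    using narrow unfolding norm_narrow_def by blast
  define r0 where "r0 = \<bar>S e1 - S e2\<bar>"
  have r0: "0 \<le> r0" "\<phi> r0 \<le> \<epsilon> / 4"
  proof -
    have "\<phi> r0 \<le> norm r0 * K"
      using K(2)[of r0] by simp
    also have "\<dots> \<le> \<epsilon> / (4 * K) * K"
      using S_small K(1) by (intro mult_right_mono) (auto simp: r0_def)
    finally show "\<phi> r0 \<le> \<epsilon> / 4"
      using K(1) by simp
  qed (simp add: r0_def)
  have Se: "S e = S e1 + S e2"
    by (rule orthogonally_additiveD[OF S e])
  then have \<phi>_Se: "\<phi> (S e) = \<phi> (S e1) + \<phi> (S e2)"
    by (simp add: add)
  have half: "S e1 \<le> (1/2) *\<^sub>R S e + r0" "S e2 \<le> (1/2) *\<^sub>R S e + r0"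
  proof -
    have eq: "2 *\<^sub>R S e1 = S e + (S e1 - S e2)" "2 *\<^sub>R S e2 = S e + (S e2 - S e1)"
      by (simp_all add: Se scaleR_2)
    have "S e1 - S e2 \<le> r0 + r0" "S e2 - S e1 \<le> r0 + r0"
      using r0(1) abs_ge_self[of "S e1 - S e2"] abs_ge_minus_self[of "S e1 - S e2"]
      by (auto simp: r0_def intro: add_increasing)
    then have "2 *\<^sub>R S e1 \<le> S e + 2 *\<^sub>R r0" "2 *\<^sub>R S e2 \<le> S e + 2 *\<^sub>R r0"
      unfolding eq by (simp_all add: scaleR_2)
    then have "(1/2) *\<^sub>R (2 *\<^sub>R S e1) \<le> (1/2) *\<^sub>R (S e + 2 *\<^sub>R r0)"
      "(1/2) *\<^sub>R (2 *\<^sub>R S e2) \<le> (1/2) *\<^sub>R (S e + 2 *\<^sub>R r0)"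
      by (simp_all only: scaleR_left_mono)
    then show "S e1 \<le> (1/2) *\<^sub>R S e + r0" "S e2 \<le> (1/2) *\<^sub>R S e + r0"
      by (simp_all add: scaleR_add_right)
  qed
  have "\<epsilon> / 4 > 0"
    using Suc.prems by simp
  obtain z1 where z1: "z1 \<in> split_diffs T e1" and or1: "\<phi> \<bar>z1\<bar> \<le> k * \<phi> (S e1) - \<eta> + \<epsilon> / 4 \<or>
      \<phi> \<bar>z1\<bar> \<le> k * \<phi> (S e1) + \<epsilon> / 4 \<and>
      (\<exists>r\<ge>0. \<bar>z1\<bar> \<le> (1/2) ^ n *\<^sub>R S e1 + r \<and> \<phi> r \<le> (2 ^ n - 1) * \<eta> + \<epsilon> / 4)"
    using Suc.IH[OF \<open>\<epsilon> / 4 > 0\<close>] by blast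
  obtain z2 where z2: "z2 \<in> split_diffs T e2" and or2: "\<phi> \<bar>z2\<bar> \<le> k * \<phi> (S e2) - \<eta> + \<epsilon> / 4 \<or>
      \<phi> \<bar>z2\<bar> \<le> k * \<phi> (S e2) + \<epsilon> / 4 \<and>
      (\<exists>r\<ge>0. \<bar>z2\<bar> \<le> (1/2) ^ n *\<^sub>R S e2 + r \<and> \<phi> r \<le> (2 ^ n - 1) * \<eta> + \<epsilon> / 4)"
    using Suc.IH[OF \<open>\<epsilon> / 4 > 0\<close>] by blast
  have z_sum: "z1 + z2 \<in> split_diffs T e" and z_diff: "z1 - z2 \<in> split_diffs T e"
    using split_diffs_add[OF T e z1 z2] by auto
  have le1: "\<phi> \<bar>z1\<bar> \<le> k * \<phi> (S e1) + \<epsilon> / 4" and le2: "\<phi> \<bar>z2\<bar> \<le> k * \<phi> (S e2) + \<epsilon> / 4"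
    using or1 or2 \<open>\<eta> \<ge> 0\<close> by auto
  have triangle: "\<phi> \<bar>z1 + z2\<bar> \<le> \<phi> \<bar>z1\<bar> + \<phi> \<bar>z2\<bar>"
    using mono[OF abs_triangle_ineq] by (simp add: add)
  have k_Se: "k * \<phi> (S e) = k * \<phi> (S e1) + k * \<phi> (S e2)"
    by (simp add: \<phi>_Se distrib_left)
  let ?goal = "\<lambda>z. \<phi> \<bar>z\<bar> \<le> k * \<phi> (S e) - \<eta> + \<epsilon>"
  \<comment> \<open>A saving already made on either half survives, by the triangle inequality and
    additivity of \<phi>. Otherwise both halves carry pointwise bounds, and the overlap of
    \<open>z1\<close> and \<open>z2\<close> decides.\<close>
  consider "?goal (z1 + z2)" | "\<eta> \<le> \<phi> (inf \<bar>z1\<bar> \<bar>z2\<bar>)"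
    | "\<phi> (inf \<bar>z1\<bar> \<bar>z2\<bar>) < \<eta>"
      "\<exists>r\<ge>0. \<bar>z1\<bar> \<le> (1/2) ^ n *\<^sub>R S e1 + r \<and> \<phi> r \<le> (2 ^ n - 1) * \<eta> + \<epsilon> / 4"
      "\<exists>r\<ge>0. \<bar>z2\<bar> \<le> (1/2) ^ n *\<^sub>R S e2 + r \<and> \<phi> r \<le> (2 ^ n - 1) * \<eta> + \<epsilon> / 4"
    using or1 or2 le1 le2 triangle k_Se Suc.prems by argo
  then show ?case
  proof cases
    case 1
    then show ?thesis
      using z_sum by blast
  next
    case 2
    have "\<phi> \<bar>z1 + z2\<bar> + \<phi> \<bar>z1 - z2\<bar> \<le> 2 * \<phi> (sup \<bar>z1\<bar> \<bar>z2\<bar>)"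
      using mono[OF abs_add_abs_diff_le[of z1 z2]] by (simp add: add linear_scale[OF lin])
    moreover have "\<phi> (sup \<bar>z1\<bar> \<bar>z2\<bar>) + \<phi> (inf \<bar>z1\<bar> \<bar>z2\<bar>) = \<phi> \<bar>z1\<bar> + \<phi> \<bar>z2\<bar>"
      by (simp add: add_eq_inf_sup[of "\<bar>z1\<bar>" "\<bar>z2\<bar>"] flip: add)
    ultimately have "?goal (z1 + z2) \<or> ?goal (z1 - z2)"
      using 2 le1 le2 k_Se Suc.prems by argo
    then show ?thesis
      using z_sum z_diff by blast
  next
    case 3
    obtain r1 r2 where r1: "0 \<le> r1" "\<bar>z1\<bar> \<le> (1/2) ^ n *\<^sub>R S e1 + r1" "\<phi> r1 \<le> (2 ^ n - 1) * \<eta> + \<epsilon> / 4"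
      and r2: "0 \<le> r2" "\<bar>z2\<bar> \<le> (1/2) ^ n *\<^sub>R S e2 + r2" "\<phi> r2 \<le> (2 ^ n - 1) * \<eta> + \<epsilon> / 4"
      using 3 by blast
    \<comment> \<open>Imbalance, both remainders and the overlap are collected here. Two remainders
      with coefficient \<open>2 ^ n - 1\<close> and one overlap below \<eta> give the coefficient
      \<open>2 ^ Suc n - 1\<close>.\<close>
    define r where "r = r0 + r1 + r2 + inf \<bar>z1\<bar> \<bar>z2\<bar>"
    have bound: "\<bar>z\<bar> \<le> (1/2) ^ Suc n *\<^sub>R S e + (r0 + r1 + r2)"
      if z: "\<bar>z\<bar> \<le> (1/2) ^ n *\<^sub>R s + q" "s \<le> (1/2) *\<^sub>R S e + r0" "q \<le> r1 + r2" for z s q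
    proof -
      have "(1/2) ^ n *\<^sub>R s \<le> (1/2) ^ n *\<^sub>R ((1/2) *\<^sub>R S e + r0)"
        using z(2) by (intro scaleR_left_mono) auto
      also have "\<dots> = (1/2) ^ Suc n *\<^sub>R S e + (1/2) ^ n *\<^sub>R r0"
        by (simp add: scaleR_add_right mult.commute)
      also have "\<dots> \<le> (1/2) ^ Suc n *\<^sub>R S e + 1 *\<^sub>R r0"
        using r0(1) by (intro add_left_mono scaleR_right_mono power_le_one) auto
      finally have "(1/2) ^ n *\<^sub>R s + q \<le> ((1/2) ^ Suc n *\<^sub>R S e + 1 *\<^sub>R r0) + (r1 + r2)"
        using z(3) by (rule add_mono)
      then show ?thesis
        using z(1) by (simp add: add.assoc)
    qed
    have "\<bar>z1 + z2\<bar> \<le> \<bar>z1\<bar> + \<bar>z2\<bar>"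
      by (rule abs_triangle_ineq)
    also have "\<dots> = sup \<bar>z1\<bar> \<bar>z2\<bar> + inf \<bar>z1\<bar> \<bar>z2\<bar>"
      by (rule add_eq_inf_sup)
    \<comment> \<open>A supremum inherits the bound common to the two halves; bounding the sum
      instead would double it and lose what the halving gained.\<close>
    also have "sup \<bar>z1\<bar> \<bar>z2\<bar> \<le> (1/2) ^ Suc n *\<^sub>R S e + (r0 + r1 + r2)"
      using bound[OF r1(2) half(1)] bound[OF r2(2) half(2)] r1(1) r2(1)
      by (intro le_supI) (auto simp: add_increasing add_increasing2)
    finally have "\<bar>z1 + z2\<bar> \<le> (1/2) ^ Suc n *\<^sub>R S e + r"
      by (simp only: r_def add.assoc add_right_mono)
    moreover have "\<phi> r = \<phi> r0 + \<phi> r1 + \<phi> r2 + \<phi> (inf \<bar>z1\<bar> \<bar>z2\<bar>)"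
      by (simp add: r_def add)
    then have "\<phi> r \<le> (2 ^ Suc n - 1) * \<eta> + \<epsilon>"
      using r0(2) r1(3) r2(3) 3(1) Suc.prems by (simp add: algebra_simps)
    moreover have "0 \<le> r"
      using r0(1) r1(1) r2(1) by (simp add: r_def)
    moreover have "\<phi> \<bar>z1 + z2\<bar> \<le> k * \<phi> (S e) + \<epsilon>"
      using triangle le1 le2 k_Se Suc.prems by argo
    ultimately show ?thesis
      using z_sum by blast
  qed
qed

text \<open>With \<open>\<eta>\<close> proportional to \<open>\<phi> (S e)\<close>, the halving step lowers every admissible constant \<open>k\<close>
  above \<open>2 * (1/2) ^ n\<close> by the fixed amount \<open>(1/4) ^ n\<close>.\<close>

lemma small_split_diff:
  fixes S T :: "'e::vector_lattice \<Rightarrow> 'g::banach_lattice"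
  assumes S: "orthogonally_additive S" and T: "orthogonally_additive T"
    and T_le: "\<And>x. \<bar>T x\<bar> \<le> S x"
    and narrow: "norm_narrow S"
    and \<phi>: "positive_functional \<phi>"
    and "\<epsilon> > 0"
  shows "\<exists>z\<in>split_diffs T e. \<phi> \<bar>z\<bar> \<le> \<epsilon>"
proof -
  \<comment> \<open>Admissibility of \<open>k\<close> is demanded for all \<open>e\<close> at once,
    because the halving step applies it to the pieces of \<open>e\<close>.\<close>
  define P where "P k \<longleftrightarrow> (\<forall>e. \<forall>\<epsilon>>0. \<exists>z\<in>split_diffs T e. \<phi> \<bar>z\<bar> \<le> k * \<phi> (S e) + \<epsilon>)" for k
  have \<phi>_nonneg: "0 \<le> \<phi> (S e)" for e
  proof -
    have "0 \<le> S e"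
      using T_le[of e] abs_ge_zero order_trans by blast
    then show ?thesis
      using \<phi> by (simp add: positive_functional_def)
  qed
  have P_1: "P 1"
    unfolding P_def
  proof (intro allI impI)
    fix e and \<epsilon> :: real
    assume "\<epsilon> > 0"
    have "T e - T 0 \<in> split_diffs T e"
      unfolding split_diffs_def using disjoint_sum_0 by blast
    moreover from positive_functional_mono[OF \<phi> abs_split_diffs_le[OF S T_le this]]
    have "\<phi> \<bar>T e - T 0\<bar> \<le> 1 * \<phi> (S e) + \<epsilon>"
      using \<open>\<epsilon> > 0\<close> by simp
    ultimately show "\<exists>z\<in>split_diffs T e. \<phi> \<bar>z\<bar> \<le> 1 * \<phi> (S e) + \<epsilon>" by blast
  qed
  have P_step: "P (max (k - (1/4) ^ n) (2 * (1/2) ^ n))" if "P k" for k n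
    unfolding P_def
  proof (intro allI impI)
    fix e and \<epsilon> :: real
    assume "\<epsilon> > 0"
    \<comment> \<open>With this choice \<open>2 ^ n * \<eta>\<close> equals
      \<open>(1/2) ^ n * \<phi> (S e)\<close>: the accumulated remainder is no larger than the main
      term, whence the factor 2 in \<open>2 * (1/2) ^ n\<close>.\<close>
    define \<eta> where "\<eta> = (1/4) ^ n * \<phi> (S e)"
    let ?k = "max (k - (1/4) ^ n) (2 * (1/2) ^ n)"
    have "\<eta> \<ge> 0"
      by (simp add: \<eta>_def \<phi>_nonneg)
    have k: "\<exists>z\<in>split_diffs T e. \<phi> \<bar>z\<bar> \<le> k * \<phi> (S e) + \<epsilon>" if "\<epsilon> > 0" for e \<epsilon>
      using \<open>P k\<close> that unfolding P_def by blast
    from halving_step[OF S T T_le narrow \<phi> k \<open>\<eta> \<ge> 0\<close> \<open>\<epsilon> > 0\<close>, of e n]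
    obtain z where z: "z \<in> split_diffs T e" and "\<phi> \<bar>z\<bar> \<le> k * \<phi> (S e) - \<eta> + \<epsilon> \<or>
        (\<exists>r. \<bar>z\<bar> \<le> (1/2) ^ n *\<^sub>R S e + r \<and> \<phi> r \<le> (2 ^ n - 1) * \<eta> + \<epsilon>)"
      by blast
    then have "\<phi> \<bar>z\<bar> \<le> ?k * \<phi> (S e) + \<epsilon>"
    proof (elim disjE exE conjE)
      assume "\<phi> \<bar>z\<bar> \<le> k * \<phi> (S e) - \<eta> + \<epsilon>"
      then have "\<phi> \<bar>z\<bar> \<le> (k - (1/4) ^ n) * \<phi> (S e) + \<epsilon>"
        by (simp add: \<eta>_def left_diff_distrib)
      also have "\<dots> \<le> ?k * \<phi> (S e) + \<epsilon>"
        using \<phi>_nonneg by (intro add_right_mono mult_right_mono) auto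
      finally show ?thesis .
    next
      fix r
      assume r: "\<bar>z\<bar> \<le> (1/2) ^ n *\<^sub>R S e + r" "\<phi> r \<le> (2 ^ n - 1) * \<eta> + \<epsilon>"
      have "2 ^ n * \<eta> = (1/2) ^ n * \<phi> (S e)"
        by (simp add: \<eta>_def flip: power_mult_distrib)
      then have "(2 ^ n - 1) * \<eta> \<le> (1/2) ^ n * \<phi> (S e)"
        using \<open>\<eta> \<ge> 0\<close> by (simp add: left_diff_distrib)
      moreover have "\<phi> \<bar>z\<bar> \<le> (1/2) ^ n * \<phi> (S e) + \<phi> r"
        using positive_functional_mono[OF \<phi> r(1)]
        by (simp add: linear_add linear_scale positive_functional_linear[OF \<phi>])
      ultimately have "\<phi> \<bar>z\<bar> \<le> (2 * (1/2) ^ n) * \<phi> (S e) + \<epsilon>"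
        using r(2) by simp
      also have "\<dots> \<le> ?k * \<phi> (S e) + \<epsilon>"
        using \<phi>_nonneg by (intro add_right_mono mult_right_mono) auto
      finally show ?thesis .
    qed
    with z show "\<exists>z\<in>split_diffs T e. \<phi> \<bar>z\<bar> \<le> ?k * \<phi> (S e) + \<epsilon>" by blast
  qed
  have P_small: "P (2 * (1/2) ^ n)" for n
  proof -
    \<comment> \<open>The decrement is the same for every \<open>k\<close>, so more than
      \<open>4 ^ n\<close> steps from \<open>k = 1\<close> exhaust the first entry of the
      maximum.\<close>
    have "P (max (1 - real m * (1/4) ^ n) (2 * (1/2) ^ n))" for m
    proof (induction m)
      case 0
      have "P (max 1 (2 * (1/2) ^ n))"
        unfolding P_def
      proof (intro allI impI)
        fix e and \<epsilon> :: real
        assume "\<epsilon> > 0"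
        then obtain z where z: "z \<in> split_diffs T e" "\<phi> \<bar>z\<bar> \<le> 1 * \<phi> (S e) + \<epsilon>"
          using P_1 unfolding P_def by blast
        have "1 * \<phi> (S e) \<le> max 1 (2 * (1/2) ^ n) * \<phi> (S e)"
          using \<phi>_nonneg by (intro mult_right_mono) auto
        with z show "\<exists>z\<in>split_diffs T e. \<phi> \<bar>z\<bar> \<le> max 1 (2 * (1/2) ^ n) * \<phi> (S e) + \<epsilon>"
          by (intro bexI[of _ z]) linarith
      qed
      then show ?case by simp
    next
      case (Suc m)
      have "max (max a b - c) b = max (a - c) b" if "c \<ge> 0" for a b c :: real
        using that by (simp add: max_def)
      then show ?case
        using P_step[OF Suc, of n] by (simp add: algebra_simps)
    qed
    moreover obtain m :: nat where "4 ^ n < real m"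
      using reals_Archimedean2 by blast
    then have "1 - real m * (1/4) ^ n \<le> 0"
      by (simp add: power_one_over field_simps)
    then have "max (1 - real m * (1/4) ^ n) (2 * (1/2) ^ n) = 2 * (1/2::real) ^ n"
      by (intro max_absorb2) (erule order_trans, simp)
    ultimately show ?thesis by metis
  qed
  \<comment> \<open>The added 1 covers the case that \<open>\<phi> (S e)\<close> vanishes; the
    factor 4 leaves half of \<epsilon> for the error term of \<open>P\<close>.\<close>
  obtain n where n: "(1/2::real) ^ n < \<epsilon> / (4 * (\<phi> (S e) + 1))"
    using real_arch_pow_inv[of "\<epsilon> / (4 * (\<phi> (S e) + 1))" "1/2"] \<open>\<epsilon> > 0\<close> \<phi>_nonneg[of e] by auto
  obtain z where z: "z \<in> split_diffs T e" "\<phi> \<bar>z\<bar> \<le> 2 * (1/2) ^ n * \<phi> (S e) + \<epsilon> / 2"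
    using P_small[of n] \<open>\<epsilon> > 0\<close> unfolding P_def by (meson half_gt_zero)
  have "(1/2) ^ n * \<phi> (S e) \<le> (1/2) ^ n * (\<phi> (S e) + 1)"
    by (intro mult_left_mono) auto
  also have "\<dots> \<le> \<epsilon> / 4"
    using n \<phi>_nonneg[of e] by (simp add: field_simps)
  finally have "\<phi> \<bar>z\<bar> \<le> \<epsilon>"
    using z(2) by simp
  then show ?thesis
    using z(1) by blast
qed

text \<open>The functional is chosen after \<open>e\<close>, for the interval from 0 to
  \<open>S e\<close>. This interval contains the moduli of all differences of splittings of
  \<open>e\<close>, so a small mean forces a small norm.\<close>

lemma norm_narrow_if_majorant:
  fixes S T :: "'e::vector_lattice \<Rightarrow> 'g::banach_lattice"
  assumes ocn: "order_continuous_norm TYPE('g)"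
    and S: "orthogonally_additive S" and T: "orthogonally_additive T"
    and T_le: "\<And>x. \<bar>T x\<bar> \<le> S x"
    and narrow: "norm_narrow S"
  shows "norm_narrow T"
  unfolding norm_narrow_def
proof (intro allI impI)
  fix e and \<epsilon> :: real
  assume "\<epsilon> > 0"
  have "0 \<le> S e"
    using T_le[of e] abs_ge_zero order_trans by blast
  moreover have "\<epsilon> / 2 > 0"
    using \<open>\<epsilon> > 0\<close> by simp
  ultimately obtain \<phi> \<delta> where \<phi>: "positive_functional \<phi>" "\<delta> > 0"
    "\<And>y. 0 \<le> y \<Longrightarrow> y \<le> S e \<Longrightarrow> \<phi> y \<le> \<delta> \<Longrightarrow> norm y \<le> \<epsilon> / 2"
    using norm_controlling_functional[OF ocn] by blast
  obtain z where z: "z \<in> split_diffs T e" "\<phi> \<bar>z\<bar> \<le> \<delta>"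
    using small_split_diff[OF S T T_le narrow \<phi>(1,2)] by blast
  have "norm z \<le> \<epsilon> / 2"
    using \<phi>(3)[OF abs_ge_zero abs_split_diffs_le[OF S T_le z(1)] z(2)] by simp
  then have "norm z < \<epsilon>"
    using \<open>\<epsilon> > 0\<close> by simp
  then show "\<exists>f g. disjoint_sum e f g \<and> norm (T f - T g) < \<epsilon>"
    using z(1) unfolding split_diffs_def by blast
qed

theorem theorem4p1:
  fixes T :: "'e::vector_lattice \<Rightarrow> 'f::vector_lattice"
    and j :: "'f \<Rightarrow> 'g::banach_lattice"
  assumes "atomless TYPE('e)"
    and "order_continuous_norm TYPE('g)"
    and "order_ideal_embedding j"
    and "T \<in> uryson_operators"
  shows "order_narrow T \<longleftrightarrow> order_narrow (uryson_modulus T)"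
proof -
  note ocn = assms(2) and j = assms(3) and T = assms(4)
  obtain M where M: "is_uryson_modulus T M" "\<And>x v. partition_sum T x v \<Longrightarrow> v \<le> M x"
    "\<And>x \<epsilon>. \<epsilon> > 0 \<Longrightarrow> \<exists>v. partition_sum T x v \<and> norm (j (M x) - j v) < \<epsilon>"
    using uryson_modulus_exists[OF ocn j T] by blast
  have M_uryson: "M \<in> uryson_operators"
    using M(1) by (simp add: is_uryson_modulus_def)
  have add: "orthogonally_additive T" "orthogonally_additive M"
    using T M_uryson by (simp_all add: uryson_operators_def)
  have j_add: "orthogonally_additive (\<lambda>x. j (T x))" "orthogonally_additive (\<lambda>x. j (M x))"
    using add linear_add[OF order_ideal_embedding_linear[OF j]]
    by (simp_all add: orthogonally_additive_def)
  have j_le: "\<bar>j (T x)\<bar> \<le> j (M x)" for x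
    using M(2)[OF partition_sum.single]
    by (simp add: order_ideal_embedding_le_iff[OF j] flip: order_ideal_embedding_abs[OF j])
  have "order_narrow T \<longleftrightarrow> norm_narrow (\<lambda>x. j (T x))"
    using order_narrow_imp_norm_narrow[OF ocn j] norm_narrow_imp_order_narrow[OF j T] by blast
  also have "\<dots> \<longleftrightarrow> norm_narrow (\<lambda>x. j (M x))"
    using norm_narrow_modulus[OF j add M(2,3)] norm_narrow_if_majorant[OF ocn j_add(2,1) j_le] by blast
  also have "\<dots> \<longleftrightarrow> order_narrow M"
    using order_narrow_imp_norm_narrow[OF ocn j] norm_narrow_imp_order_narrow[OF j M_uryson] by blast
  finally show ?thesis
    by (simp add: uryson_modulus_eqI[OF M(1)])
qed

end
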